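(* Let $l,m,n,s$ be nonnegative integers such that $m\ge1$, $n\ge3$ is odd, and if $m$ is odd then $m\ge n$. Let $G=(T_1(w_1),T_2(w_2),\dots,T_m(w_m))$ be a unicyclic graph with a cycle of length $m$, and let $D_1$ be an oriented graph obtained from $G$ by considering a strong orientation of its cycle (other edges oriented arbitrarily). Let $C_n^+$ be a strongly oriented cycle on an $n$-element vertex set and $C_n^-$ its reverse on the same vertex set. Assume that $(a_0^l,a_1^l,\dots,a_l^l)$ is any sequence of nonnegative integers such that $a_0^0=n$ when $l=0$, and, when $l\ge1$, $$\sum_{i=0}^l\frac{a_i^l}{n^{l-i}}=n\quad\text{and}\quad\sum_{i=0}^k\frac{a_i^l}{n^{k-i+1}}\in\mathbb{Z}^+\ \text{ for each } k=0,1,\dots,l-1.$$ Then there exist a sequence of digraphs $D_i$ and a sequence of functions $h_i:E(D_i)\to\{C_n^+,C_n^-\}$, $i=1,\dots,l+s+1$, such that $D_{i+1}=D_i\otimes_{h_i}\{C_n^+,C_n^-\}$, $$G^{n^s}\cong\mathrm{und}(D_{s+1})\quad\text{and}\quad\sum_{i=0}^l a_i^l\,G^{n^{s+i}}\cong\mathrm{und}(D_{l+s+2}).$$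
   Context: Notation: for trees $T_1,\dots,T_m$ and $w_j\in V(T_j)$, $(T_1(w_1),\dots,T_m(w_m))$ is the unicyclic graph obtained from a cycle $a_1\cdots a_m$ and disjoint copies of the $T_j$ by identifying $w_j$ with $a_j$. For $G=(T_1(w_1),\dots,T_m(w_m))$ and $k\ge1$, $G^k$ denotes $(T_1(w_1),\dots,T_m(w_m),\dots,T_1(w_1),\dots,T_m(w_m))$ with the block of $m$ entries repeated $k$ times (a unicyclic graph with cycle of length $mk$). $aH$ denotes $a$ disjoint copies of $H$ and the sum is disjoint union. Product: for a digraph $D$, a family $\Gamma$ of digraphs with common vertex set $V$ and $h:E(D)\to\Gamma$, $D\otimes_h\Gamma$ has vertex set $V(D)\times V$ and $((a,x),(b,y))$ is an arc iff $(a,b)\in E(D)$ and $(x,y)\in E(h(a,b))$. $\mathrm{und}$ is underlying graph. $\mathbb{Z}^+$ denotes the positive integers. *)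

theory Defs
  imports Complex_Main "Graph_Theory.Graph_Theory"
begin

text \<open>
  Undirected graphs have named edges, so that parallel edges and loops are possible: the
  unicyclic graph \<open>(T\<^sub>1(w\<^sub>1), T\<^sub>2(w\<^sub>2))\<close> has a cycle of length 2, i.e. a pair of parallel edges, and
  \<open>und\<close> must not merge the two arcs of a 2-cycle. For graphs without parallel edges this is the
  usual notion of graph. The ends of an edge form a set with one (loop) or two elements.
\<close>

record ('v, 'e) ugraph =
  uverts :: "'v set"
  uedges :: "'e set"
  uends :: "'e \<Rightarrow> 'v set"

definition ugraph_iso :: "('v, 'e) ugraph \<Rightarrow> ('w, 'f) ugraph \<Rightarrow> bool" where
  "ugraph_iso G H \<longleftrightarrow> (\<exists>f g. bij_betw f (uverts G) (uverts H) \<and> bij_betw g (uedges G) (uedges H) \<and>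
     (\<forall>e\<in>uedges G. uends H (g e) = f ` uends G e))"

definition wf_ugraph :: "('v, 'e) ugraph \<Rightarrow> bool" where
  "wf_ugraph G \<longleftrightarrow> (\<forall>e\<in>uedges G. \<exists>u\<in>uverts G. \<exists>v\<in>uverts G. uends G e = {u, v})"

definition uconnected :: "('v, 'e) ugraph \<Rightarrow> bool" where
  "uconnected G \<longleftrightarrow> uverts G \<noteq> {} \<and>
     (\<forall>u\<in>uverts G. \<forall>v\<in>uverts G. (u, v) \<in> {(x, y). \<exists>e\<in>uedges G. uends G e = {x, y}}\<^sup>*)"

text \<open>
  The cycle through \<open>a 0, ..., a (m - 1)\<close>, whose edge \<open>j\<close> joins \<open>a j\<close> to its successor; for
  \<open>m = 1\<close> a loop, for \<open>m = 2\<close> a pair of parallel edges.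
\<close>

definition cycle_ugraph :: "nat \<Rightarrow> (nat \<Rightarrow> 'v) \<Rightarrow> ('v, nat) ugraph" where
  "cycle_ugraph m a =
     \<lparr>uverts = a ` {..<m}, uedges = {..<m}, uends = (\<lambda>j. {a j, a (Suc j mod m)})\<rparr>"

definition uacyclic :: "('v, 'e) ugraph \<Rightarrow> bool" where
  "uacyclic G \<longleftrightarrow> \<not> (\<exists>m a g. m \<ge> 1 \<and> inj_on a {..<m} \<and> inj_on g {..<m} \<and>
     a ` {..<m} \<subseteq> uverts G \<and> g ` {..<m} \<subseteq> uedges G \<and>
     (\<forall>j<m. uends G (g j) = uends (cycle_ugraph m a) j))"

text \<open>The constant \<open>tree\<close> of \<open>Graph_Theory\<close> only excludes directed cycles.\<close>

definition is_tree :: "('v, 'e) ugraph \<Rightarrow> bool" where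
  "is_tree T \<longleftrightarrow> wf_ugraph T \<and> finite (uverts T) \<and> uconnected T \<and> uacyclic T"

text \<open>
  The graph \<open>(T\<^sub>1(w\<^sub>1), ..., T\<^sub>m(w\<^sub>m))\<close>, indexed from 0. Vertex \<open>(j, v)\<close> is the copy of \<open>v\<close> in the
  \<open>j\<close>-th tree; the cycle vertex identified with \<open>w j\<close> is represented by \<open>(j, w j)\<close>. Edges are tree
  edges \<open>Inl (j, e)\<close> and cycle edges \<open>Inr j\<close>.
\<close>

definition unicyclic ::
  "nat \<Rightarrow> (nat \<Rightarrow> ('v, 'e) ugraph) \<Rightarrow> (nat \<Rightarrow> 'v) \<Rightarrow> (nat \<times> 'v, nat \<times> 'e + nat) ugraph" where
  "unicyclic m T w =
     \<lparr>uverts = (SIGMA j:{..<m}. uverts (T j)),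
      uedges = (SIGMA j:{..<m}. uedges (T j)) <+> {..<m},
      uends = case_sum (\<lambda>(j, e). Pair j ` uends (T j) e) (uends (cycle_ugraph m (\<lambda>j. (j, w j))))\<rparr>"

text \<open>The graph \<open>G\<^sup>k\<close> for \<open>G = unicyclic m T w\<close>.\<close>

definition unicyclic_power ::
  "nat \<Rightarrow> (nat \<Rightarrow> ('v, 'e) ugraph) \<Rightarrow> (nat \<Rightarrow> 'v) \<Rightarrow> nat \<Rightarrow> (nat \<times> 'v, nat \<times> 'e + nat) ugraph" where
  "unicyclic_power m T w k = unicyclic (m * k) (\<lambda>j. T (j mod m)) (\<lambda>j. w (j mod m))"

definition disjoint_union ::
  "'i set \<Rightarrow> ('i \<Rightarrow> ('v, 'e) ugraph) \<Rightarrow> ('i \<times> 'v, 'i \<times> 'e) ugraph" where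
  "disjoint_union I H =
     \<lparr>uverts = (SIGMA i:I. uverts (H i)), uedges = (SIGMA i:I. uedges (H i)),
      uends = (\<lambda>(i, e). Pair i ` uends (H i) e)\<rparr>"

definition copies :: "nat \<Rightarrow> ('v, 'e) ugraph \<Rightarrow> (nat \<times> 'v, nat \<times> 'e) ugraph" where
  "copies a H = disjoint_union {..<a} (\<lambda>_. H)"

definition und :: "'v pair_pre_digraph \<Rightarrow> ('v, 'v \<times> 'v) ugraph" where
  "und D = \<lparr>uverts = pverts D, uedges = parcs D, uends = (\<lambda>(u, v). {u, v})\<rparr>"

text \<open>
  An orientation is given by the arc \<open>r e\<close> chosen for each edge \<open>e\<close>. Injectivity says that no two
  parallel edges become the same arc, since a digraph has no parallel arcs.
\<close>

definition is_orientation :: "('v, 'e) ugraph \<Rightarrow> ('e \<Rightarrow> 'v \<times> 'v) \<Rightarrow> bool" where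
  "is_orientation G r \<longleftrightarrow>
     inj_on r (uedges G) \<and> (\<forall>e\<in>uedges G. uends G e = {fst (r e), snd (r e)})"

definition orient :: "('v, 'e) ugraph \<Rightarrow> ('e \<Rightarrow> 'v \<times> 'v) \<Rightarrow> 'v pair_pre_digraph" where
  "orient G r = \<lparr>pverts = uverts G, parcs = r ` uedges G\<rparr>"

definition is_strong_orientation :: "('v, 'e) ugraph \<Rightarrow> ('e \<Rightarrow> 'v \<times> 'v) \<Rightarrow> bool" where
  "is_strong_orientation G r \<longleftrightarrow>
     is_orientation G r \<and> strongly_connected (with_proj (orient G r))"

definition strongly_oriented_cycle :: "nat \<Rightarrow> 'v pair_pre_digraph \<Rightarrow> bool" where
  "strongly_oriented_cycle n C \<longleftrightarrow> (\<exists>a r. inj_on a {..<n} \<and>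
     is_strong_orientation (cycle_ugraph n a) r \<and> C = orient (cycle_ugraph n a) r)"

definition reverse_digraph :: "'v pair_pre_digraph \<Rightarrow> 'v pair_pre_digraph" where
  "reverse_digraph D = \<lparr>pverts = pverts D, parcs = (parcs D)\<inverse>\<rparr>"

definition cycle_strong_orientation ::
  "nat \<Rightarrow> (nat \<Rightarrow> ('v, 'e) ugraph) \<Rightarrow> (nat \<Rightarrow> 'v) \<Rightarrow> (nat \<times> 'v) pair_pre_digraph \<Rightarrow> bool" where
  "cycle_strong_orientation m T w D \<longleftrightarrow> (\<exists>r. is_orientation (unicyclic m T w) r \<and>
     is_strong_orientation (cycle_ugraph m (\<lambda>j. (j, w j))) (r \<circ> Inr) \<and>
     D = orient (unicyclic m T w) r)"

text \<open>
  The product \<open>D \<otimes>\<^sub>h \<Gamma>\<close>; the parameter \<open>V\<close> is the common vertex set of the family \<open>\<Gamma>\<close>.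
\<close>

definition h_product ::
  "'a pair_pre_digraph \<Rightarrow> 'b set \<Rightarrow> ('a \<times> 'a \<Rightarrow> 'b pair_pre_digraph) \<Rightarrow> ('a \<times> 'b) pair_pre_digraph"
where
  "h_product D V h =
     \<lparr>pverts = pverts D \<times> V,
      parcs = {((a, x), (b, y)) | a x b y. (a, b) \<in> parcs D \<and> (x, y) \<in> parcs (h (a, b))}\<rparr>"

text \<open>
  The vertex set of an iterated product is \<open>((V(D\<^sub>1) \<times> V) \<times> V) \<times> ...\<close>. The following type
  contains all these sets: \<open>IPair\<close> plays the role of pairing and \<open>Base\<close> embeds \<open>V(D\<^sub>1)\<close>.
\<close>

datatype ('a, 'b) iterated_vertex = Base 'a | IPair "('a, 'b) iterated_vertex" 'b

definition relabel :: "('a \<Rightarrow> 'b) \<Rightarrow> 'a pair_pre_digraph \<Rightarrow> 'b pair_pre_digraph" where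
  "relabel f D = \<lparr>pverts = f ` pverts D, parcs = map_prod f f ` parcs D\<rparr>"

end

theory Submission
  imports Defs
begin

text \<open>
  Every \<open>D\<^sub>i\<close> is a lift of \<open>D\<^sub>1\<close>: finitely many layers, with a permutation \<open>\<sigma>\<close> of the layers applied
  along the arc that closes the cycle. A \<open>\<sigma>\<close>-cycle of length \<open>k\<close> gives a component \<open>G\<^sup>k\<close>. Trees carry
  potentials, so in a product with \<open>C\<^sub>n\<^sup>+\<close> and \<open>C\<^sub>n\<^sup>-\<close> only the signs along the cycle matter, and these can
  be chosen in each layer such that their sum is \<open>0\<close> or coprime to \<open>n\<close> (modulo \<open>n\<close>); for odd \<open>m\<close> the sum
  \<open>-n\<close> requires \<open>m \<ge> n\<close>. Hence each \<open>\<sigma>\<close>-cycle can either be split into \<open>n\<close> cycles of the same length or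
  be replaced by one that is \<open>n\<close> times as long. Starting with \<open>s\<close> prolongations, the required
  numbers of components are reached by deciding backwards which ones arise by a split; the
  integrality conditions say exactly that this is possible.
\<close>

section \<open>Strong orientations of a cycle\<close>

lemma Suc_mod_inj:
  assumes "i < m" "j < m" "Suc i mod m = Suc j mod m"
  shows "i = j"
  using assms by (auto simp: mod_Suc split: if_splits)

text \<open>Strong connectivity gives every vertex an outgoing arc. If one edge points forward, the
  arc leaving its head cannot be that same edge, so it is the next edge, again pointing forward.
  Hence one forward edge makes all edges forward.\<close>

lemma strong_orientation_cycle_cases:
  assumes m: "m \<ge> 2" and inj: "inj_on a {..<m}"
    and strong: "is_strong_orientation (cycle_ugraph m a) r"
  shows "(\<forall>j<m. r j = (a j, a (Suc j mod m))) \<or> (\<forall>j<m. r j = (a (Suc j mod m), a j))"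
proof -
  have ends: "{a j, a (Suc j mod m)} = {fst (r j), snd (r j)}" if "j < m" for j
    using strong that
    by (auto simp: is_strong_orientation_def is_orientation_def cycle_ugraph_def)
  have a_eq: "a i = a j \<longleftrightarrow> i = j" if "i < m" "j < m" for i j
    using inj that by (auto simp: inj_on_def)
  have next_ne: "Suc j mod m \<noteq> j" if "j < m" for j
    using that m by (auto simp: mod_Suc)
  have out: "\<exists>i<m. fst (r i) = a j" if j: "j < m" for j
  proof -
    let ?D = "with_proj (orient (cycle_ugraph m a) r)"
    have "a j \<rightarrow>\<^sup>*\<^bsub>?D\<^esub> a (Suc j mod m)"
      using strong j m
      by (auto simp: is_strong_orientation_def strongly_connected_def orient_def cycle_ugraph_def)
    moreover have "a j \<noteq> a (Suc j mod m)"
      using a_eq[of j "Suc j mod m"] next_ne[OF j] j m by simp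
    ultimately obtain v where "a j \<rightarrow>\<^bsub>?D\<^esub> v"
      by (metis pre_digraph.converse_reachable_cases)
    then have "(a j, v) \<in> parcs (orient (cycle_ugraph m a) r)" by simp
    then show ?thesis
      by (auto simp: orient_def cycle_ugraph_def intro: bexI) (metis fst_conv)
  qed
  have step: "r (Suc i mod m) = (a (Suc i mod m), a (Suc (Suc i mod m) mod m))"
    if i: "i < m" and fw: "r i = (a i, a (Suc i mod m))" for i
  proof -
    define j where "j = Suc i mod m"
    have j: "j < m" using m by (simp add: j_def)
    obtain k where k: "k < m" "fst (r k) = a j" using out[OF j] by blast
    have "a j \<in> {a k, a (Suc k mod m)}" using ends[OF k(1)] k(2) by auto
    then have "j = k \<or> j = Suc k mod m"
      using a_eq[OF j k(1)] a_eq[of j "Suc k mod m"] j m by auto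
    moreover have "j \<noteq> Suc k mod m"
    proof
      assume "j = Suc k mod m"
      then have "k = i" using Suc_mod_inj[OF k(1) i] by (simp add: j_def)
      then show False using k fw a_eq[OF i j] next_ne[OF i] by (simp add: j_def)
    qed
    ultimately have "k = j" by simp
    then have "fst (r j) = a j" using k by simp
    moreover have "snd (r j) = a (Suc j mod m)"
      using ends[OF j] \<open>fst (r j) = a j\<close> by (auto simp: doubleton_eq_iff)
    ultimately show ?thesis by (metis j_def prod.collapse)
  qed
  show ?thesis
  proof (cases "\<exists>i<m. r i = (a i, a (Suc i mod m))")
    case True
    then obtain i where i: "i < m" "r i = (a i, a (Suc i mod m))" by blast
    have "r ((i + k) mod m) = (a ((i + k) mod m), a (Suc ((i + k) mod m) mod m))" for k
    proof (induction k)
      case 0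
      then show ?case using i by simp
    next
      case (Suc k)
      have "(i + Suc k) mod m = Suc ((i + k) mod m) mod m" by (simp add: mod_Suc_eq)
      then show ?case using step[of "(i + k) mod m", OF _ Suc] m by simp
    qed
    note all = this
    have "r j = (a j, a (Suc j mod m))" if j: "j < m" for j
    proof -
      have "(i + (m - i + j)) mod m = j" using i(1) j by simp
      then show ?thesis using all[of "m - i + j"] by simp
    qed
    then show ?thesis by blast
  next
    case False
    have "r j = (a (Suc j mod m), a j)" if j: "j < m" for j
      using ends[OF j] False j by (metis doubleton_eq_iff prod.collapse)
    then show ?thesis by blast
  qed
qed

section \<open>Potentials on forests\<close>

text \<open>Induction from the front: when the new start already lies on the path, the part of the
  path before it is cut off.\<close>

lemma rtrancl_imp_simple_path:
  assumes "(u, v) \<in> R\<^sup>*"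
  shows "\<exists>p. p \<noteq> [] \<and> hd p = u \<and> last p = v \<and> distinct p \<and>
    (\<forall>i. Suc i < length p \<longrightarrow> (p ! i, p ! Suc i) \<in> R)"
  using assms
proof (induction rule: converse_rtrancl_induct)
  case base
  show ?case by (rule exI[of _ "[v]"]) simp
next
  case (step u u')
  then obtain p where p: "p \<noteq> []" "hd p = u'" "last p = v" "distinct p"
    and R: "\<And>i. Suc i < length p \<Longrightarrow> (p ! i, p ! Suc i) \<in> R" by blast
  show ?case
  proof (cases "u \<in> set p")
    case True
    then obtain k where k: "k < length p" "p ! k = u" by (metis in_set_conv_nth)
    show ?thesis
      by (rule exI[of _ "drop k p"]) (use k p R in \<open>auto simp: hd_drop_conv_nth\<close>)
  next
    case False
    show ?thesis
      by (rule exI[of _ "u # p"])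
        (use False p R step.hyps in \<open>auto simp: nth_Cons hd_conv_nth split: nat.splits\<close>)
  qed
qed

text \<open>A simple path between the ends of \<open>e\<close> that avoids \<open>e\<close> would
  close up with \<open>e\<close> to a cycle. The case \<open>u = v\<close> is included: the path is
  then a single vertex and \<open>e\<close> a loop.\<close>

lemma uacyclic_bridge:
  assumes acyc: "uacyclic G" and wf: "wf_ugraph G" and e: "e \<in> uedges G" "uends G e = {u, v}"
    and E: "E \<subseteq> uedges G" "e \<notin> E"
  shows "(v, u) \<notin> {(x, y). \<exists>f\<in>E. uends G f = {x, y}}\<^sup>*"
proof
  assume "(v, u) \<in> {(x, y). \<exists>f\<in>E. uends G f = {x, y}}\<^sup>*"
  then obtain p where p: "p \<noteq> []" "hd p = v" "last p = u" "distinct p"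
    and R: "\<And>i. Suc i < length p \<Longrightarrow> \<exists>f\<in>E. uends G f = {p ! i, p ! Suc i}"
    using rtrancl_imp_simple_path[of v u "{(x, y). \<exists>f\<in>E. uends G f = {x, y}}"] by auto
  define M where "M = length p"
  have M: "M \<ge> 1" using p(1) by (cases p) (auto simp: M_def)
  obtain h where h: "\<And>i. Suc i < M \<Longrightarrow> h i \<in> E \<and> uends G (h i) = {p ! i, p ! Suc i}"
    using R unfolding M_def by metis
  \<comment> \<open>The edges of the closed walk: at the last index, \<open>e\<close> leads from
    \<open>u\<close> back to \<open>v\<close>. Path edges differ from one another because the
    vertices of \<open>p\<close> are distinct, and from \<open>e\<close> because \<open>e\<close> is
    not in \<open>E\<close>.\<close>
  define g where "g i = (if Suc i < M then h i else e)" for i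
  have nth_eq: "p ! i = p ! j \<longleftrightarrow> i = j" if "i < M" "j < M" for i j
    using p(4) that by (simp add: M_def nth_eq_iff_index_eq)
  have last: "p ! (M - 1) = u" "p ! 0 = v"
    using p by (auto simp: M_def last_conv_nth hd_conv_nth)
  have g_ends: "uends G (g j) = {p ! j, p ! (Suc j mod M)}" if "j < M" for j
  proof (cases "Suc j < M")
    case True
    then show ?thesis using h[of j] by (simp add: g_def)
  next
    case False
    then have "Suc j = M" using that by simp
    then show ?thesis using e(2) last unfolding g_def by fastforce
  qed
  have g_edge: "g j \<in> uedges G" for j
    using h[of j] e(1) E(1) unfolding g_def by (cases "Suc j < M") auto
  have "inj_on g {..<M}"
  proof (rule inj_onI)
    fix i j assume ij: "i \<in> {..<M}" "j \<in> {..<M}" "g i = g j"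
    show "i = j"
    proof (cases "Suc i < M \<and> Suc j < M")
      case True
      then have "{p ! i, p ! Suc i} = {p ! j, p ! Suc j}"
        using h[of i] h[of j] ij(3) by (simp add: g_def)
      then show ?thesis using True nth_eq by (auto simp: doubleton_eq_iff)
    next
      case False
      then have "\<not> Suc i < M \<and> \<not> Suc j < M"
        using h[of i] h[of j] ij(3) E(2) unfolding g_def by metis
      then show ?thesis using ij by simp
    qed
  qed
  moreover have "inj_on (\<lambda>i. p ! i) {..<M}"
    using nth_eq by (auto simp: inj_on_def)
  moreover have "(\<lambda>i. p ! i) ` {..<M} \<subseteq> uverts G"
  proof clarify
    fix j assume "j < M"
    then have "p ! j \<in> uends G (g j)" using g_ends by simp
    then show "p ! j \<in> uverts G" using wf g_edge[of j] by (fastforce simp: wf_ugraph_def)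
  qed
  moreover have "g ` {..<M} \<subseteq> uedges G" using g_edge by blast
  ultimately have "\<not> uacyclic G"
    unfolding uacyclic_def cycle_ugraph_def using M g_ends
    by (intro iffD2[OF not_not] exI[of _ M] exI[of _ "\<lambda>i. p ! i"] exI[of _ g]) auto
  then show False using acyc by simp
qed

text \<open>Two edges with equal ends would contradict \<open>uacyclic_bridge\<close>, so an edge is
  determined by its set of ends, a subset of the finite vertex set. The induction for the potential
  needs this finiteness.\<close>

lemma forest_finite_edges:
  assumes acyc: "uacyclic G" and wf: "wf_ugraph G" and fin: "finite (uverts G)"
  shows "finite (uedges G)"
proof -
  have "inj_on (uends G) (uedges G)"
  proof (rule inj_onI, rule ccontr)
    fix e f assume ef: "e \<in> uedges G" "f \<in> uedges G" "uends G e = uends G f" "e \<noteq> f"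
    obtain u v where uv: "uends G e = {u, v}" using wf ef(1) by (auto simp: wf_ugraph_def)
    have "(v, u) \<in> {(x, y). \<exists>e'\<in>{f}. uends G e' = {x, y}}\<^sup>*"
      using uv ef(3) by (intro r_into_rtrancl) auto
    then show False
      using uacyclic_bridge[OF acyc wf ef(1) uv, of "{f}"] ef by simp
  qed
  moreover have "uends G ` uedges G \<subseteq> Pow (uverts G)"
    using wf by (fastforce simp: wf_ugraph_def)
  ultimately show ?thesis
    using fin by (meson finite_Pow_iff finite_imageD finite_subset)
qed

text \<open>Edges are added one at a time. Each new edge is a bridge, so the values on one side of
  it can be adjusted without affecting the edges already treated.\<close>

lemma forest_potential_edges:
  fixes r :: "'e \<Rightarrow> 'v \<times> 'v"
  assumes acyc: "uacyclic G" and wf: "wf_ugraph G"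
    and r: "\<And>e. e \<in> uedges G \<Longrightarrow> uends G e = {fst (r e), snd (r e)}"
    and E: "finite E" "E \<subseteq> uedges G"
  shows "\<exists>g :: 'v \<Rightarrow> int. \<forall>e\<in>E. g (snd (r e)) = g (fst (r e)) + 1"
  using E
proof (induction rule: finite_induct)
  case empty
  then show ?case by simp
next
  case (insert e E)
  then obtain g :: "'v \<Rightarrow> int" where g: "\<forall>e\<in>E. g (snd (r e)) = g (fst (r e)) + 1" by blast
  let ?R = "{(x, y). \<exists>f\<in>E. uends G f = {x, y}}"
  let ?S = "{x. (snd (r e), x) \<in> ?R\<^sup>*}"
  have notin: "fst (r e) \<notin> ?S"
    using uacyclic_bridge[OF acyc wf, of e "fst (r e)" "snd (r e)" E] r insert by simp
  \<comment> \<open>Shift \<open>g\<close> on the component of the head of \<open>e\<close>.\<close>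
  define g' where
    "g' x = (if x \<in> ?S then g x + (g (fst (r e)) + 1 - g (snd (r e))) else g x)" for x
  have "g' (snd (r f)) = g' (fst (r f)) + 1" if f: "f \<in> E" for f
  proof -
    have "uends G f = {fst (r f), snd (r f)}" using r f insert by blast
    then have "(fst (r f), snd (r f)) \<in> ?R" "(snd (r f), fst (r f)) \<in> ?R"
      using f by blast+
    from rtrancl_into_rtrancl[OF _ this(1)] rtrancl_into_rtrancl[OF _ this(2)]
    have "fst (r f) \<in> ?S \<longleftrightarrow> snd (r f) \<in> ?S"
      unfolding mem_Collect_eq by blast
    then show ?thesis using g f by (simp add: g'_def)
  qed
  moreover have "g' (snd (r e)) = g' (fst (r e)) + 1"
    using notin by (simp add: g'_def)
  ultimately show ?case by blast
qed

lemma tree_potential: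
  fixes r :: "'e \<Rightarrow> 'v \<times> 'v"
  assumes "is_tree G" and "\<And>e. e \<in> uedges G \<Longrightarrow> uends G e = {fst (r e), snd (r e)}"
  shows "\<exists>g :: 'v \<Rightarrow> int. g w = 0 \<and> (\<forall>e\<in>uedges G. g (snd (r e)) = g (fst (r e)) + 1)"
proof -
  obtain g :: "'v \<Rightarrow> int" where "\<forall>e\<in>uedges G. g (snd (r e)) = g (fst (r e)) + 1"
    using forest_potential_edges[of G r "uedges G"] forest_finite_edges[of G] assms
    by (auto simp: is_tree_def)
  then show ?thesis by (intro exI[of _ "\<lambda>x. g x - g w"]) auto
qed

section \<open>Lifts of a digraph along a permutation\<close>

definition twist :: "'e \<Rightarrow> ('f \<Rightarrow> 'f) \<Rightarrow> 'e \<Rightarrow> 'f \<Rightarrow> 'f" where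
  "twist z \<sigma> e f = (if e = z then \<sigma> f else f)"

text \<open>For a permutation \<open>\<sigma>\<close> of \<open>F\<close>, this is the covering of
  \<open>G\<close> derived from a permutation voltage assignment that is trivial on all arcs but
  \<open>z\<close>.\<close>

definition lift ::
  "'v pair_pre_digraph \<Rightarrow> 'v \<times> 'v \<Rightarrow> 'f set \<Rightarrow> ('f \<Rightarrow> 'f) \<Rightarrow> ('f \<times> 'v) pair_pre_digraph" where
  "lift G z F \<sigma> =
     \<lparr>pverts = F \<times> pverts G,
      parcs = {((f, fst e), (twist z \<sigma> e f, snd e)) | f e. f \<in> F \<and> e \<in> parcs G}\<rparr>"

lemma parcs_lift:
  "parcs (lift G z F \<sigma>) = (\<lambda>(f, e). ((f, fst e), (twist z \<sigma> e f, snd e))) ` (F \<times> parcs G)"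
  by (auto simp: lift_def image_iff) (metis fst_conv snd_conv)

text \<open>Layers and base are tied to \<open>D\<close> only through an injective vertex map, so
  that layers can be renamed freely and \<open>D\<close> can be moved into
  \<open>iterated_vertex\<close>.\<close>

definition is_lift ::
  "'v pair_pre_digraph \<Rightarrow> 'v \<times> 'v \<Rightarrow> 'f set \<Rightarrow> ('f \<Rightarrow> 'f) \<Rightarrow> 'w pair_pre_digraph \<Rightarrow> bool" where
  "is_lift G z F \<sigma> D \<longleftrightarrow>
     (\<exists>\<phi>. inj_on \<phi> (F \<times> pverts G) \<and> D = relabel \<phi> (lift G z F \<sigma>))"

lemma relabel_relabel: "relabel f (relabel g D) = relabel (f \<circ> g) D"
  by (simp add: relabel_def image_comp map_prod.comp)

lemma is_lift_relabel:
  assumes "is_lift G z F \<sigma> D" and "inj_on \<psi> (pverts D)"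
  shows "is_lift G z F \<sigma> (relabel \<psi> D)"
proof -
  obtain \<phi> where \<phi>: "inj_on \<phi> (F \<times> pverts G)" "D = relabel \<phi> (lift G z F \<sigma>)"
    using assms(1) by (auto simp: is_lift_def)
  then have "inj_on (\<psi> \<circ> \<phi>) (F \<times> pverts G)"
    using assms(2) by (intro comp_inj_on) (auto simp: relabel_def lift_def)
  then show ?thesis
    unfolding is_lift_def
    using \<phi>(2) by (intro exI[of _ "\<psi> \<circ> \<phi>"]) (simp add: relabel_relabel)
qed

text \<open>Only the conjugacy class of the permutation matters. This allows the layers to be
  brought back to the standard form given by \<open>fibre\<close> and \<open>rot\<close> after every
  product.\<close>

lemma is_lift_conjugate:
  assumes lift: "is_lift G z F \<sigma> D" and wf: "parcs G \<subseteq> pverts G \<times> pverts G"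
    and bij: "bij_betw \<gamma> F' F" and equiv: "\<And>f. f \<in> F' \<Longrightarrow> \<gamma> (\<sigma>' f) = \<sigma> (\<gamma> f)"
  shows "is_lift G z F' \<sigma>' D"
proof -
  obtain \<phi> where \<phi>: "inj_on \<phi> (F \<times> pverts G)" "D = relabel \<phi> (lift G z F \<sigma>)"
    using lift by (auto simp: is_lift_def)
  let ?\<gamma> = "map_prod \<gamma> id :: _ \<times> 'a \<Rightarrow> _"
  have img: "?\<gamma> ` (F' \<times> pverts G) = F \<times> pverts G"
    using bij by (auto simp: bij_betw_def map_prod_def image_iff)
  have "inj_on ?\<gamma> (F' \<times> pverts G)"
    using bij by (auto simp: bij_betw_def inj_on_def)
  then have inj: "inj_on (\<phi> \<circ> ?\<gamma>) (F' \<times> pverts G)"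
    using \<phi>(1) img by (intro comp_inj_on) auto
  have tw: "\<gamma> (twist z \<sigma>' e f) = twist z \<sigma> e (\<gamma> f)" if "f \<in> F'" for e f
    using equiv[OF that] by (simp add: twist_def)
  have "map_prod ?\<gamma> ?\<gamma> ` parcs (lift G z F' \<sigma>') = parcs (lift G z F \<sigma>)"
  proof (intro equalityI subsetI)
    fix a assume "a \<in> map_prod ?\<gamma> ?\<gamma> ` parcs (lift G z F' \<sigma>')"
    then obtain f e where fe: "f \<in> F'" "e \<in> parcs G"
      and a: "a = ((\<gamma> f, fst e), (\<gamma> (twist z \<sigma>' e f), snd e))"
      by (auto simp: lift_def)
    moreover have "\<gamma> f \<in> F" using bij fe by (auto simp: bij_betw_def)
    ultimately show "a \<in> parcs (lift G z F \<sigma>)"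
      using tw[OF fe(1), of e] unfolding lift_def by (simp only: pair_pre_digraph.simps) blast
  next
    fix a assume "a \<in> parcs (lift G z F \<sigma>)"
    then obtain f e where fe: "f \<in> F" "e \<in> parcs G"
      and a: "a = ((f, fst e), (twist z \<sigma> e f, snd e))"
      by (auto simp: lift_def)
    obtain f' where f': "f' \<in> F'" "f = \<gamma> f'" using bij fe(1) by (auto simp: bij_betw_def)
    have "a = map_prod ?\<gamma> ?\<gamma> ((f', fst e), (twist z \<sigma>' e f', snd e))"
      using a f' tw[OF f'(1), of e] by simp
    moreover have "((f', fst e), (twist z \<sigma>' e f', snd e)) \<in> parcs (lift G z F' \<sigma>')"
      using f' fe unfolding lift_def by (simp only: pair_pre_digraph.simps) blast
    ultimately show "a \<in> map_prod ?\<gamma> ?\<gamma> ` parcs (lift G z F' \<sigma>')" by (rule image_eqI)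
  qed
  then have "relabel ?\<gamma> (lift G z F' \<sigma>') = lift G z F \<sigma>"
    using img by (simp add: relabel_def lift_def)
  then have "D = relabel (\<phi> \<circ> ?\<gamma>) (lift G z F' \<sigma>')"
    using \<phi>(2) by (simp add: relabel_relabel[symmetric])
  then show ?thesis using inj unfolding is_lift_def by blast
qed

text \<open>
  The factors \<open>P\<close> and \<open>M\<close> contribute \<open>\<epsilon> = 1\<close> and \<open>\<epsilon> = -1\<close> to the second coordinate. The potential
  \<open>\<pi>\<close> absorbs these contributions on all arcs but \<open>z\<close>, where the total \<open>d\<close> is left over.
\<close>

lemma h_product_is_lift:
  fixes n :: int and x :: "int \<Rightarrow> 'c" and P M :: "'c pair_pre_digraph"
    and \<epsilon> :: "'f \<Rightarrow> 'v \<times> 'v \<Rightarrow> int" and \<pi> :: "'f \<Rightarrow> 'v \<Rightarrow> int"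
  assumes n: "n > 0" and x_eq: "\<And>i j. x i = x j \<longleftrightarrow> i mod n = j mod n"
    and P: "parcs P = range (\<lambda>i. (x i, x (i + 1)))"
    and M: "parcs M = range (\<lambda>i. (x (i + 1), x i))"
    and wf: "parcs G \<subseteq> pverts G \<times> pverts G"
    and \<sigma>: "\<And>f. f \<in> F \<Longrightarrow> \<sigma> f \<in> F"
    and sign: "\<And>f e. f \<in> F \<Longrightarrow> e \<in> parcs G \<Longrightarrow> \<epsilon> f e = 1 \<or> \<epsilon> f e = - 1"
    and pot: "\<And>f e. f \<in> F \<Longrightarrow> e \<in> parcs G \<Longrightarrow>
      \<pi> f (fst e) + \<epsilon> f e = (if e = z then d f else 0) + \<pi> (twist z \<sigma> e f) (snd e)"
    and lift: "is_lift G z F \<sigma> D"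
  shows "\<exists>h. h \<in> parcs D \<rightarrow> {P, M} \<and>
    is_lift G z (F \<times> {0..<n}) (\<lambda>(f, y). (\<sigma> f, (y + d f) mod n)) (h_product D (range x) h)"
proof -
  obtain \<phi> where \<phi>: "inj_on \<phi> (F \<times> pverts G)" and D: "D = relabel \<phi> (lift G z F \<sigma>)"
    using lift by (auto simp: is_lift_def)
  have \<phi>_eq: "\<phi> (f, p) = \<phi> (f', p') \<longleftrightarrow> f = f' \<and> p = p'"
    if "f \<in> F" "f' \<in> F" "p \<in> pverts G" "p' \<in> pverts G" for f f' p p'
    using \<phi> that by (auto simp: inj_on_def)
  have tw: "twist z \<sigma> e f \<in> F" if "f \<in> F" for e f
    using that \<sigma> by (simp add: twist_def)
  have e_in: "fst e \<in> pverts G" "snd e \<in> pverts G" if "e \<in> parcs G" for e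
    using that wf by auto
  define arc where "arc f e = (\<phi> (f, fst e), \<phi> (twist z \<sigma> e f, snd e))" for f e
  have arc_eq: "f = f' \<and> e = e'"
    if "arc f e = arc f' e'" "f \<in> F" "f' \<in> F" "e \<in> parcs G" "e' \<in> parcs G" for f f' e e'
    using that \<phi>_eq tw e_in by (simp add: arc_def prod_eq_iff)
  have parcs_D: "parcs D = {arc f e | f e. f \<in> F \<and> e \<in> parcs G}"
    unfolding D relabel_def lift_def arc_def by (auto simp: image_iff)
  have pverts_D: "pverts D = \<phi> ` (F \<times> pverts G)"
    by (simp add: D relabel_def lift_def)
  \<comment> \<open>The sign of an arc is decoded into a factor. Everything else, also outside the
    arcs of \<open>D\<close>, is sent to \<open>M\<close>. By \<open>arc_eq\<close> an arc of
    \<open>D\<close> determines its layer and base arc, so its sign is unambiguous.\<close>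
  define h where "h b = (if \<exists>f\<in>F. \<exists>e\<in>parcs G. b = arc f e \<and> \<epsilon> f e = 1 then P else M)" for b
  have parcs_h: "parcs (h (arc f e)) = range (\<lambda>i. (x i, x (i + \<epsilon> f e)))"
    if fe: "f \<in> F" "e \<in> parcs G" for f e
  proof (cases "\<epsilon> f e = 1")
    case True
    then have "h (arc f e) = P" using fe unfolding h_def by auto
    then show ?thesis using True P by simp
  next
    case False
    then have "h (arc f e) = M" using arc_eq fe unfolding h_def by metis
    \<comment> \<open>The reversed cycle, indexed by tails instead of heads.\<close>
    moreover have "range (\<lambda>i. (x (i + 1), x i)) = range (\<lambda>i. (x i, x (i + (- 1))))"
    proof (intro equalityI subsetI; elim rangeE)
      fix a i assume "a = (x (i + 1), x i)"
      then have "a = (\<lambda>i. (x i, x (i + (- 1)))) (i + 1)" by simp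
      then show "a \<in> range (\<lambda>i. (x i, x (i + (- 1))))" by blast
    next
      fix a i assume "a = (x i, x (i + (- 1)))"
      then have "a = (\<lambda>i. (x (i + 1), x i)) (i - 1)" by simp
      then show "a \<in> range (\<lambda>i. (x (i + 1), x i))" by blast
    qed
    ultimately show ?thesis using False sign[OF fe] M by simp
  qed
  \<comment> \<open>Layer \<open>(f, y)\<close> passes over the vertex \<open>p\<close> at height
    \<open>y + \<pi> f p\<close>. By the potential equation, \<open>y\<close> is then constant along
    every arc but \<open>z\<close>, where it grows by \<open>d f\<close>.\<close>
  define \<phi>' where "\<phi>' = (\<lambda>((f, y), p). (\<phi> (f, p), x (y + \<pi> f p)))"
  define \<sigma>' where "\<sigma>' = (\<lambda>(f, y). (\<sigma> f, (y + d f) mod n))"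
  let ?F = "F \<times> {0..<n}"
  have "inj_on \<phi>' (?F \<times> pverts G)"
  proof (rule inj_onI)
    fix a a' assume a: "a \<in> ?F \<times> pverts G" "a' \<in> ?F \<times> pverts G" and eq: "\<phi>' a = \<phi>' a'"
    obtain f y p f' y' p' where aa: "a = ((f, y), p)" "a' = ((f', y'), p')" by (metis prod.exhaust)
    have f: "f = f'" "p = p'" using a eq \<phi>_eq by (auto simp: aa \<phi>'_def)
    have "(y + \<pi> f p) mod n = (y' + \<pi> f p) mod n"
      using eq f by (simp add: aa \<phi>'_def x_eq)
    then have "y mod n = y' mod n" by (metis add_diff_cancel_right' mod_diff_left_eq)
    then show "a = a'" using a f by (simp add: aa)
  qed
  moreover have "h_product D (range x) h = relabel \<phi>' (lift G z ?F \<sigma>')"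
  proof -
    have V: "pverts D \<times> range x = \<phi>' ` (?F \<times> pverts G)"
    proof (intro equalityI subsetI)
      fix a assume "a \<in> pverts D \<times> range x"
      then obtain f p i where f: "f \<in> F" "p \<in> pverts G" "a = (\<phi> (f, p), x i)"
        unfolding pverts_D by auto
      have "x i = x ((i - \<pi> f p) mod n + \<pi> f p)" by (simp add: x_eq mod_simps)
      then have "a = \<phi>' ((f, (i - \<pi> f p) mod n), p)" using f by (simp add: \<phi>'_def)
      then show "a \<in> \<phi>' ` (?F \<times> pverts G)" using f n by auto
    qed (auto simp: \<phi>'_def pverts_D)
    have tw': "x (snd (twist z \<sigma>' e (f, y)) + \<pi> (twist z \<sigma> e f) (snd e)) = x (y + \<pi> f (fst e) + \<epsilon> f e)"
      "fst (twist z \<sigma>' e (f, y)) = twist z \<sigma> e f"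
      if "f \<in> F" "e \<in> parcs G" for f e y
      using pot[OF that] unfolding x_eq
      by (auto simp: twist_def \<sigma>'_def mod_simps add.assoc)
    have \<phi>'_tw: "\<phi>' (twist z \<sigma>' e (f, y), snd e) =
        (\<phi> (twist z \<sigma> e f, snd e), x (y + \<pi> f (fst e) + \<epsilon> f e))"
      if "f \<in> F" "e \<in> parcs G" for f e y
      using tw'[OF that, of y] unfolding \<phi>'_def by (auto split: prod.split)
    have A: "parcs (h_product D (range x) h) =
      map_prod \<phi>' \<phi>' ` {((f, fst e), (twist z \<sigma>' e f, snd e)) | f e. f \<in> ?F \<and> e \<in> parcs G}"
      (is "?L = map_prod \<phi>' \<phi>' ` ?R")
    proof (intro equalityI subsetI)
      fix b assume "b \<in> ?L"
      then obtain g x1 x2 where g: "g \<in> parcs D" "(x1, x2) \<in> parcs (h g)"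
          "b = ((fst g, x1), (snd g, x2))"
        by (auto simp: h_product_def)
      then obtain f e where fe: "f \<in> F" "e \<in> parcs G"
        and b: "b = ((fst (arc f e), x1), (snd (arc f e), x2))" "(x1, x2) \<in> parcs (h (arc f e))"
        unfolding parcs_D by blast
      then obtain i where i: "x1 = x i" "x2 = x (i + \<epsilon> f e)" using parcs_h by auto
      \<comment> \<open>The layer whose height over the tail of \<open>e\<close> is
        \<open>i\<close>, reduced to the representative in \<open>{0..<n}\<close>.\<close>
      define y where "y = (i - \<pi> f (fst e)) mod n"
      have "x i = x (y + \<pi> f (fst e))" "x (i + \<epsilon> f e) = x (y + \<pi> f (fst e) + \<epsilon> f e)"
        by (simp_all add: y_def x_eq mod_simps add.assoc)
      then have "b = map_prod \<phi>' \<phi>' (((f, y), fst e), (twist z \<sigma>' e (f, y), snd e))"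
        using b i \<phi>'_tw[OF fe, of y] by (simp add: arc_def) (simp add: \<phi>'_def)
      moreover have "(((f, y), fst e), (twist z \<sigma>' e (f, y), snd e)) \<in> ?R"
        using fe n by (intro CollectI exI[of _ "(f, y)"] exI[of _ e]) (simp add: y_def)
      ultimately show "b \<in> map_prod \<phi>' \<phi>' ` ?R" by (rule image_eqI)
    next
      fix b assume "b \<in> map_prod \<phi>' \<phi>' ` ?R"
      then obtain f y e where fe: "f \<in> F" "e \<in> parcs G"
        and "b = map_prod \<phi>' \<phi>' (((f, y), fst e), (twist z \<sigma>' e (f, y), snd e))"
        by fastforce
      then have b: "b = ((fst (arc f e), x (y + \<pi> f (fst e))),
          (snd (arc f e), x (y + \<pi> f (fst e) + \<epsilon> f e)))"
        using \<phi>'_tw[OF fe, of y] by (simp add: arc_def) (simp add: \<phi>'_def)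
      have "(x (y + \<pi> f (fst e)), x (y + \<pi> f (fst e) + \<epsilon> f e)) \<in> parcs (h (arc f e))"
        using parcs_h[OF fe] by auto
      moreover have "arc f e \<in> parcs D" using fe parcs_D by blast
      ultimately show "b \<in> ?L"
        unfolding b h_product_def pair_pre_digraph.simps
        by (intro CollectI exI conjI) (rule refl, simp_all)
    qed
    show ?thesis
      using V A by (simp add: relabel_def lift_def h_product_def)
  qed
  ultimately have "is_lift G z ?F \<sigma>' (h_product D (range x) h)"
    unfolding is_lift_def by blast
  moreover have "h \<in> parcs D \<rightarrow> {P, M}" by (auto simp: h_def)
  ultimately show ?thesis unfolding \<sigma>'_def by blast
qed

section \<open>Cycle types\<close>

text \<open>
  In the fibre \<open>fibre n c\<close> the permutation \<open>rot n\<close> has exactly \<open>c i\<close> cycles of length \<open>n ^ i\<close>.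
\<close>

definition fibre :: "nat \<Rightarrow> (nat \<Rightarrow> nat) \<Rightarrow> (nat \<times> nat \<times> nat) set" where
  "fibre n c = {(i, q, t). q < c i \<and> t < n ^ i}"

fun rot :: "nat \<Rightarrow> nat \<times> nat \<times> nat \<Rightarrow> nat \<times> nat \<times> nat" where
  "rot n (i, q, t) = (i, q, Suc t mod n ^ i)"

lemma rot_in_fibre: "n > 0 \<Longrightarrow> f \<in> fibre n c \<Longrightarrow> rot n f \<in> fibre n c"
  by (auto simp: fibre_def)

text \<open>
  Of the \<open>c i\<close> cycles of length \<open>n ^ i\<close>, the first \<open>b i\<close> are split into \<open>n\<close> cycles of the same
  length, and each other one is replaced by a cycle that is \<open>n\<close> times as long.
\<close>

definition type_step :: "nat \<Rightarrow> (nat \<Rightarrow> nat) \<Rightarrow> (nat \<Rightarrow> nat) \<Rightarrow> (nat \<Rightarrow> nat) \<Rightarrow> bool" where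
  "type_step n b c c' \<longleftrightarrow> (\<forall>i. b i \<le> c i) \<and> c' 0 = n * b 0 \<and>
     (\<forall>i. c' (Suc i) = n * b (Suc i) + (c i - b i))"

text \<open>Over a cycle on which \<open>d\<close> vanishes modulo \<open>n\<close> the second
  coordinate is constant, which gives \<open>n\<close> cycles of the old length. Over any other
  cycle a full turn adds \<open>u\<close>. Since \<open>u\<close> generates the integers modulo
  \<open>n\<close>, the orbit closes only after \<open>n\<close> turns.\<close>

lemma type_step_conjugate:
  fixes u :: int
  assumes n: "n > 0" and u: "coprime u (int n)" and step: "type_step n b c c'"
    and d: "\<And>i q t. q < c i \<Longrightarrow> t < n ^ i \<Longrightarrow>
      d (i, q, t) mod int n = (if q < b i \<or> Suc t < n ^ i then 0 else u) mod int n"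
  shows "\<exists>\<gamma>. bij_betw \<gamma> (fibre n c') (fibre n c \<times> {0..<int n}) \<and>
    (\<forall>f\<in>fibre n c'. \<gamma> (rot n f) = (\<lambda>(f, y). (rot n f, (y + d f) mod int n)) (\<gamma> f))"
proof -
  have b_le: "b i \<le> c i" and c'0: "c' 0 = n * b 0"
    and c'S: "c' (Suc i) = n * b (Suc i) + (c i - b i)" for i
    using step by (auto simp: type_step_def)
  \<comment> \<open>In the first branch \<open>q\<close> encodes an old split cycle and a residue.
    In the second, \<open>b (i - 1)\<close> skips the split cycles, and \<open>t\<close> encodes the
    number of completed turns together with the position in the current turn. The truncated
    \<open>0 - 1\<close> never matters: for \<open>i = 0\<close> all cycles of \<open>c'\<close>
    come from splitting.\<close>
  define \<gamma> :: "nat \<times> nat \<times> nat \<Rightarrow> (nat \<times> nat \<times> nat) \<times> int" where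
    "\<gamma> = (\<lambda>(i, q, t). if q < n * b i then ((i, q div n, t), int (q mod n))
       else ((i - 1, q - n * b i + b (i - 1), t mod n ^ (i - 1)),
             u * int (t div n ^ (i - 1)) mod int n))"
  have \<gamma>1: "\<gamma> (i, q, t) = ((i, q div n, t), int (q mod n))" if "q < n * b i" for i q t
    using that by (simp add: \<gamma>_def)
  have \<gamma>2: "\<gamma> (Suc i, n * b (Suc i) + q, t) =
      ((i, q + b i, t mod n ^ i), u * int (t div n ^ i) mod int n)" for i q t
    by (simp add: \<gamma>_def)
  have cases: thesis
    if mem: "f \<in> fibre n c'" and split: "\<And>i q t. f = (i, q, t) \<Longrightarrow> q < n * b i \<Longrightarrow> t < n ^ i \<Longrightarrow> thesis"
      and unite: "\<And>i q t. f = (Suc i, n * b (Suc i) + q, t) \<Longrightarrow> q < c i - b i \<Longrightarrow> t < n ^ Suc i \<Longrightarrow> thesis"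
    for f thesis
  proof -
    obtain i q t where f: "f = (i, q, t)" "q < c' i" "t < n ^ i"
      using mem by (auto simp: fibre_def)
    show thesis
    proof (cases "q < n * b i")
      case True
      then show thesis using split f by blast
    next
      case False
      then obtain k where k: "i = Suc k" using f c'0 by (cases i) auto
      obtain q' where "q = n * b i + q'" using False by (metis le_Suc_ex not_less)
      then show thesis using unite[of k q' t] f k c'S[of k] by simp
    qed
  qed
  have "inj_on \<gamma> (fibre n c')"
  proof (rule inj_onI)
    fix f f' assume f: "f \<in> fibre n c'" and f': "f' \<in> fibre n c'" and eq: "\<gamma> f = \<gamma> f'"
    have divlt: "q div n < b i" if "q < n * b i" for q i
      using that by (simp add: less_mult_imp_div_less mult.commute)
    show "f = f'"
    proof (rule cases[OF f]; rule cases[OF f'])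
      fix i q t i' q' t'
      assume *: "f = (i, q, t)" "q < n * b i" "f' = (i', q', t')" "q' < n * b i'"
      then show "f = f'" using eq by (auto simp: \<gamma>1) (metis div_mult_mod_eq)
    next
      fix i q t i' q' t'
      assume "f = (i, q, t)" "q < n * b i" "f' = (Suc i', n * b (Suc i') + q', t')"
      then show "f = f'" using eq divlt[of q i] by (simp add: \<gamma>1 \<gamma>2)
    next
      fix i q t i' q' t'
      assume "f = (Suc i, n * b (Suc i) + q, t)" "f' = (i', q', t')" "q' < n * b i'"
      then show "f = f'" using eq divlt[of q' i'] by (auto simp: \<gamma>1 \<gamma>2)
    next
      fix i q t i' q' t'
      assume *: "f = (Suc i, n * b (Suc i) + q, t)" "t < n ^ Suc i"
        "f' = (Suc i', n * b (Suc i') + q', t')" "t' < n ^ Suc i'"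
      have i: "i = i'" "q = q'" "t mod n ^ i = t' mod n ^ i"
        using eq * by (auto simp: \<gamma>2)
      \<comment> \<open>The second coordinate determines the number of completed turns:
        \<open>u\<close> can be cancelled modulo \<open>n\<close>, and both counts are below
        \<open>n\<close>.\<close>
      have "u * int (t div n ^ i) mod int n = u * int (t' div n ^ i) mod int n"
        using eq * i by (simp add: \<gamma>2)
      then have "int n dvd u * (int (t div n ^ i) - int (t' div n ^ i))"
        by (simp add: mod_eq_dvd_iff right_diff_distrib)
      then have "int n dvd int (t div n ^ i) - int (t' div n ^ i)"
        using u by (simp add: coprime_commute coprime_dvd_mult_right_iff)
      then have "int (t div n ^ i) mod int n = int (t' div n ^ i) mod int n"
        by (simp add: mod_eq_dvd_iff)
      moreover have "t div n ^ i < n" "t' div n ^ i < n"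
        using *(2,4) i(1) by (auto simp: less_mult_imp_div_less)
      ultimately have "t div n ^ i = t' div n ^ i" by (simp flip: zmod_int)
      then have "t = t'" using i(3) by (metis div_mult_mod_eq)
      then show "f = f'" using * i by simp
    qed
  qed
  moreover have "\<gamma> ` fibre n c' = fibre n c \<times> {0..<int n}"
  proof (intro equalityI subsetI)
    fix a assume "a \<in> \<gamma> ` fibre n c'"
    then obtain f where f: "f \<in> fibre n c'" "a = \<gamma> f" by blast
    show "a \<in> fibre n c \<times> {0..<int n}"
    proof (rule cases[OF f(1)])
      fix i q t assume *: "f = (i, q, t)" "q < n * b i" "t < n ^ i"
      then have "q div n < b i" by (simp add: less_mult_imp_div_less mult.commute)
      then have "q div n < c i" using b_le[of i] by linarith
      then show ?thesis using * f(2) n by (simp add: \<gamma>1 fibre_def)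
    next
      fix i q t assume "f = (Suc i, n * b (Suc i) + q, t)" "q < c i - b i" "t < n ^ Suc i"
      then show ?thesis using f(2) n by (simp add: \<gamma>2 fibre_def)
    qed
  next
    fix a assume "a \<in> fibre n c \<times> {0..<int n}"
    then obtain i q t y where a: "a = ((i, q, t), y)" "q < c i" "t < n ^ i" "0 \<le> y" "y < int n"
      by (auto simp: fibre_def)
    show "a \<in> \<gamma> ` fibre n c'"
    proof (cases "q < b i")
      case True
      have lt: "q * n + nat y < n * b i"
      proof -
        have "q * n + nat y < Suc q * n" using a(4,5) by (simp add: nat_less_iff)
        also have "\<dots> \<le> b i * n" using True by (intro mult_le_mono1) simp
        finally show ?thesis by (simp add: mult.commute)
      qed
      have "nat y < n" using a by linarith
      then have "a = \<gamma> (i, q * n + nat y, t)"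
        using lt a by (simp add: \<gamma>1)
      moreover have "n * b i \<le> c' i" using c'0 c'S by (cases i) auto
      then have "(i, q * n + nat y, t) \<in> fibre n c'"
        using lt a by (simp add: fibre_def)
      ultimately show ?thesis by blast
    next
      case False
      \<comment> \<open>With \<open>v\<close> an inverse of \<open>u\<close> modulo
        \<open>n\<close>, \<open>z\<close> is the number of turns after which the second coordinate
        equals \<open>y\<close>.\<close>
      obtain v where v: "(u * v) mod int n = 1 mod int n"
        using u by (metis (no_types) bezout_int coprime_iff_gcd_eq_1 mod_mult_self2 mult.commute
            mod_mult_self3 mod_mult_self1)
      define z where "z = v * y mod int n"
      have z: "0 \<le> z" "z < int n" using n by (auto simp: z_def)
      have "u * z mod int n = (u * v) mod int n * y mod int n"
        by (simp add: z_def mod_simps mult.assoc)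
      also have "\<dots> = y" using a by (simp add: v mod_simps)
      finally have uz: "u * z mod int n = y" .
      let ?f = "(Suc i, n * b (Suc i) + (q - b i), t + n ^ i * nat z)"
      have "a = \<gamma> ?f"
        unfolding \<gamma>2 using False a uz z n by simp
      moreover have "?f \<in> fibre n c'"
      proof -
        have "t + n ^ i * nat z < n ^ i * Suc (nat z)" using a by simp
        also have "\<dots> \<le> n ^ i * n" using z by (intro mult_le_mono2) linarith
        finally show ?thesis using False a c'S[of i] by (simp add: fibre_def mult.commute)
      qed
      ultimately show ?thesis by blast
    qed
  qed
  moreover have "\<gamma> (rot n f) = (\<lambda>(f, y). (rot n f, (y + d f) mod int n)) (\<gamma> f)"
    if f: "f \<in> fibre n c'" for f
  proof (rule cases[OF f])
    fix i q t assume *: "f = (i, q, t)" "q < n * b i" "t < n ^ i"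
    then have qd: "q div n < b i" by (simp add: less_mult_imp_div_less mult.commute)
    then have "d (i, q div n, t) mod int n = 0"
      using d[of "q div n" i t] b_le[of i] * by simp
    then have "(int (q mod n) + d (i, q div n, t)) mod int n = int (q mod n)"
      by (metis add.right_neutral mod_add_right_eq mod_mod_trivial zmod_int)
    then show ?thesis using * by (simp add: \<gamma>1)
  next
    fix i q t assume *: "f = (Suc i, n * b (Suc i) + q, t)" "q < c i - b i" "t < n ^ Suc i"
    define k where "k = n ^ i"
    have k: "k > 0" using n by (simp add: k_def)
    have tk: "t div k < n" using *(3) by (simp add: k_def less_mult_imp_div_less)
    have m1: "(Suc t mod (n * k)) mod k = Suc (t mod k) mod k"
      by (simp add: mod_mod_cancel mod_Suc_eq)
    \<comment> \<open>The turn counter advances, modulo \<open>n\<close>, exactly when the position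
      within the turn wraps around. This is also the only place where \<open>d\<close> contributes
      \<open>u\<close>.\<close>
    have m2: "(Suc t mod (n * k)) div k = (if Suc (t mod k) = k then Suc (t div k) else t div k) mod n"
    proof -
      have "Suc t mod (k * n) = k * (Suc t div k mod n) + Suc t mod k"
        by (rule mod_mult2_eq)
      then have "(Suc t mod (k * n)) div k = (Suc t div k) mod n"
        using k by simp
      moreover have "Suc t div k = (if Suc (t mod k) = k then Suc (t div k) else t div k)"
        by (simp add: div_Suc mod_Suc)
      ultimately show ?thesis by (simp add: mult.commute)
    qed
    have dd: "d (i, q + b i, t mod k) mod int n = (if Suc (t mod k) = k then u else 0) mod int n"
    proof -
      have "t mod k < k" using k by simp
      then have "Suc (t mod k) < k \<longleftrightarrow> Suc (t mod k) \<noteq> k" by linarith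
      then show ?thesis using d[of "q + b i" i "t mod k"] * k by (simp add: k_def)
    qed
    have "(u * int (t div k) mod int n + d (i, q + b i, t mod k)) mod int n =
        (u * int (t div k) + d (i, q + b i, t mod k) mod int n) mod int n"
      by (simp add: mod_simps)
    also have "\<dots> = u * int ((Suc t mod (n * k)) div k) mod int n"
      unfolding dd m2 by (simp add: zmod_int mod_simps algebra_simps)
    finally show ?thesis using * m1 by (simp add: \<gamma>2 k_def[symmetric])
  qed
  ultimately show ?thesis unfolding bij_betw_def by blast
qed

section \<open>Isomorphisms of undirected graphs\<close>

lemma ugraph_iso_trans:
  assumes "ugraph_iso G H" and "ugraph_iso H K"
  shows "ugraph_iso G K"
proof -
  obtain f g where f: "bij_betw f (uverts G) (uverts H)" and g: "bij_betw g (uedges G) (uedges H)"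
    and fg: "\<And>e. e \<in> uedges G \<Longrightarrow> uends H (g e) = f ` uends G e"
    using assms(1) by (auto simp: ugraph_iso_def)
  obtain f' g' where f': "bij_betw f' (uverts H) (uverts K)" and g': "bij_betw g' (uedges H) (uedges K)"
    and fg': "\<And>e. e \<in> uedges H \<Longrightarrow> uends K (g' e) = f' ` uends H e"
    using assms(2) by (auto simp: ugraph_iso_def)
  have "uends K ((g' \<circ> g) e) = (f' \<circ> f) ` uends G e" if "e \<in> uedges G" for e
  proof -
    have "g e \<in> uedges H" using g that by (auto simp: bij_betw_def)
    then show ?thesis using fg[OF that] fg' by (simp add: image_comp)
  qed
  then show ?thesis
    unfolding ugraph_iso_def using bij_betw_trans[OF f f'] bij_betw_trans[OF g g'] by blast
qed

text \<open>Presents a single graph as a sum with one summand and one copy, so that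
  \<open>und_lift_iso\<close> also covers the intermediate graph.\<close>

lemma ugraph_iso_single_copy: "ugraph_iso (H 0) (disjoint_union {0..0 :: nat} (\<lambda>i. copies (Suc 0) (H i)))"
  unfolding ugraph_iso_def disjoint_union_def copies_def
  by (rule exI[of _ "\<lambda>v. (0, 0, v)"], rule exI[of _ "\<lambda>e. (0, 0, e)"])
    (auto simp: bij_betw_def inj_on_def image_iff)

section \<open>Lifts of unicyclic graphs\<close>

text \<open>With \<open>p\<close> positive signs the sum is \<open>2 * p - m\<close>. For even
  \<open>m\<close> the values 0 and 2 are taken, and 2 is coprime to the odd \<open>n\<close>. For
  odd \<open>m\<close> the values \<open>-n\<close> and 1 are taken, the former being within reach
  because \<open>m \<ge> n\<close>.\<close>

lemma sign_sums:
  fixes m n :: nat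
  assumes m: "m \<ge> 1" and n: "odd n" and mn: "odd m \<Longrightarrow> m \<ge> n"
  shows "\<exists>u (s0 :: nat \<Rightarrow> int) s1. coprime u (int n) \<and>
    (\<forall>j. s0 j = 1 \<or> s0 j = -1) \<and> (\<forall>j. s1 j = 1 \<or> s1 j = -1) \<and>
    (\<Sum>j<m. s0 j) mod int n = 0 \<and> (\<Sum>j<m. s1 j) mod int n = u mod int n"
proof -
  define s :: "nat \<Rightarrow> nat \<Rightarrow> int" where "s p j = (if j < p then 1 else -1)" for p j
  have sum: "(\<Sum>j<m. s p j) = 2 * int p - int m" if "p \<le> m" for p
  proof -
    have "{..<m} \<inter> {j. j < p} = {..<p}" "{..<m} \<inter> - {j. j < p} = {p..<m}" using that by auto
    then show ?thesis using that by (simp add: s_def sum.If_cases)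
  qed
  have sgn: "s p j = 1 \<or> s p j = -1" for p j by (simp add: s_def)
  show ?thesis
  proof (cases "even m")
    case True
    then obtain p where p: "m = 2 * p" by (rule evenE)
    have "coprime 2 (int n)" using n by simp
    then show ?thesis
      using sum[of p] sum[of "Suc p"] p m sgn
      by (intro exI[of _ 2] exI[of _ "s p"] exI[of _ "s (Suc p)"]) auto
  next
    case False
    then obtain p where p: "m = 2 * p + 1" by (rule oddE)
    obtain k where k: "n = 2 * k + 1" using n by (rule oddE)
    have "k \<le> p" using mn False p k by simp
    then have "(\<Sum>j<m. s (p - k) j) = - int n"
      using sum[of "p - k"] p k by simp
    moreover have "(\<Sum>j<m. s (Suc p) j) = 1"
      using sum[of "Suc p"] p by simp
    ultimately show ?thesis
      using sgn by (intro exI[of _ 1] exI[of _ "s (p - k)"] exI[of _ "s (Suc p)"]) auto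
  qed
qed

text \<open>The cycle is assumed to run in the direction of increasing indices. The opposite
  direction is reduced to this one by reversing all arcs.\<close>

locale unicyclic_orientation =
  fixes m :: nat and T :: "nat \<Rightarrow> ('v, 'e) ugraph" and w :: "nat \<Rightarrow> 'v"
    and r :: "nat \<times> 'e + nat \<Rightarrow> (nat \<times> 'v) \<times> (nat \<times> 'v)"
  assumes m_ge_2: "m \<ge> 2"
    and trees: "\<And>j. j < m \<Longrightarrow> is_tree (T j) \<and> w j \<in> uverts (T j)"
    and orientation: "is_orientation (unicyclic m T w) r"
    and forward: "\<And>j. j < m \<Longrightarrow> r (Inr j) = ((j, w j), (Suc j mod m, w (Suc j mod m)))"
begin

abbreviation G :: "(nat \<times> 'v) pair_pre_digraph" where
  "G \<equiv> orient (unicyclic m T w) r"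

abbreviation z :: "(nat \<times> 'v) \<times> (nat \<times> 'v)" where
  "z \<equiv> ((m - 1, w (m - 1)), (0, w 0))"

section \<open>Arcs and potentials of the oriented unicyclic graph\<close>

lemma tree_arc:
  assumes "j < m" "e \<in> uedges (T j)"
  shows "{fst (r (Inl (j, e))), snd (r (Inl (j, e)))} = Pair j ` uends (T j) e"
proof -
  have "Inl (j, e) \<in> uedges (unicyclic m T w)" using assms by (auto simp: unicyclic_def)
  then have "uends (unicyclic m T w) (Inl (j, e)) = {fst (r (Inl (j, e))), snd (r (Inl (j, e)))}"
    using orientation by (auto simp only: is_orientation_def)
  then show ?thesis by (simp add: unicyclic_def)
qed

lemma tree_arcE:
  assumes "j < m" "e \<in> uedges (T j)"
  obtains u v where "r (Inl (j, e)) = ((j, u), (j, v))" "uends (T j) e = {u, v}"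
    "u \<in> uverts (T j)" "v \<in> uverts (T j)"
proof -
  obtain p q where pq: "r (Inl (j, e)) = (p, q)" by (cases "r (Inl (j, e))")
  have *: "{p, q} = Pair j ` uends (T j) e" using tree_arc[OF assms] pq by simp
  then have "p \<in> Pair j ` uends (T j) e" "q \<in> Pair j ` uends (T j) e" by blast+
  then obtain u v where uv: "p = (j, u)" "q = (j, v)" by blast
  have "snd ` {p, q} = uends (T j) e" unfolding * by (simp add: image_comp)
  then have ends: "uends (T j) e = {u, v}" using uv by simp
  moreover have "uends (T j) e \<subseteq> uverts (T j)"
    using trees[OF assms(1)] assms(2) by (fastforce simp: is_tree_def wf_ugraph_def)
  ultimately show thesis using that pq uv by simp
qed

lemma parcs_cases:
  assumes "e \<in> parcs G"
  obtains (tree) j e' u v where "j < m" "e' \<in> uedges (T j)" "e = ((j, u), (j, v))"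
      "e = r (Inl (j, e'))" "u \<in> uverts (T j)" "v \<in> uverts (T j)"
    | (cyc) j where "j < m" "e = ((j, w j), (Suc j mod m, w (Suc j mod m)))"
proof -
  obtain E where E: "E \<in> uedges (unicyclic m T w)" "e = r E" using assms by (auto simp: orient_def)
  show thesis
  proof (cases E)
    case (Inl je)
    then obtain j e' where je: "E = Inl (j, e')" "j < m" "e' \<in> uedges (T j)"
      using E by (auto simp: unicyclic_def)
    then show thesis using tree_arcE[OF je(2,3)] E tree by metis
  next
    case (Inr j)
    then have "j < m" using E by (auto simp: unicyclic_def)
    then show thesis using cyc E Inr forward by simp
  qed
qed

lemma wf_G: "parcs G \<subseteq> pverts G \<times> pverts G"
proof
  fix e assume "e \<in> parcs G"
  then show "e \<in> pverts G \<times> pverts G"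
    by (cases rule: parcs_cases) (use trees in \<open>auto simp: orient_def unicyclic_def\<close>)
qed

lemma Suc_mod_ne: "j < m \<Longrightarrow> Suc j mod m \<noteq> j"
  using m_ge_2 by (auto simp: mod_Suc)

text \<open>Normalised to 0 at the roots, the tree potentials vanish on the cycle and can be added
  to partial sums of signs along it.\<close>

lemma potential:
  obtains g :: "nat \<Rightarrow> 'v \<Rightarrow> int"
  where "\<And>j. j < m \<Longrightarrow> g j (w j) = 0"
    and "\<And>j e u v. j < m \<Longrightarrow> e \<in> uedges (T j) \<Longrightarrow> r (Inl (j, e)) = ((j, u), (j, v)) \<Longrightarrow>
      g j v = g j u + 1"
proof -
  have "\<exists>g :: 'v \<Rightarrow> int. j < m \<longrightarrow> g (w j) = 0 \<and>
      (\<forall>e\<in>uedges (T j). g (snd (snd (r (Inl (j, e))))) = g (snd (fst (r (Inl (j, e))))) + 1)" for j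
  proof (cases "j < m")
    case True
    have "uends (T j) e = {fst (map_prod snd snd (r (Inl (j, e)))),
        snd (map_prod snd snd (r (Inl (j, e))))}" if "e \<in> uedges (T j)" for e
      by (rule tree_arcE[OF True that]) simp
    then show ?thesis
      using tree_potential[of "T j" "\<lambda>e. map_prod snd snd (r (Inl (j, e)))" "w j"] trees[OF True]
      by simp
  qed simp
  then obtain g :: "nat \<Rightarrow> 'v \<Rightarrow> int" where "\<And>j. j < m \<Longrightarrow> g j (w j) = 0 \<and>
      (\<forall>e\<in>uedges (T j). g j (snd (snd (r (Inl (j, e))))) = g j (snd (fst (r (Inl (j, e))))) + 1)"
    by metis
  then show thesis using that by (metis fst_conv snd_conv)
qed

text \<open>Realises a prescribed \<open>type_step\<close> by one product: the signs are chosen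
  layer by layer, \<open>h_product_is_lift\<close> yields a skew product of \<open>rot\<close>, and
  \<open>type_step_conjugate\<close> brings it to standard form.\<close>

lemma h_product_type_step:
  fixes n :: nat and x :: "int \<Rightarrow> 'c" and P M :: "'c pair_pre_digraph"
  assumes n: "odd n" and mn: "odd m \<Longrightarrow> m \<ge> n"
    and x_eq: "\<And>i j. x i = x j \<longleftrightarrow> i mod int n = j mod int n"
    and P: "parcs P = range (\<lambda>i. (x i, x (i + 1)))"
    and M: "parcs M = range (\<lambda>i. (x (i + 1), x i))"
    and step: "type_step n b c c'"
    and lift: "is_lift G z (fibre n c) (rot n) D"
  shows "\<exists>h. h \<in> parcs D \<rightarrow> {P, M} \<and>
    is_lift G z (fibre n c') (rot n) (h_product D (range x) h)"
proof -
  have n0: "n > 0" using n by (rule odd_pos)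
  obtain g where gw: "\<And>j. j < m \<Longrightarrow> g j (w j) = 0"
    and g: "\<And>j e u v. j < m \<Longrightarrow> e \<in> uedges (T j) \<Longrightarrow> r (Inl (j, e)) = ((j, u), (j, v)) \<Longrightarrow>
      g j v = g j u + (1 :: int)"
    using potential by blast
  obtain u and s0 s1 :: "nat \<Rightarrow> int" where u: "coprime u (int n)"
    and s01: "\<And>j. s0 j = 1 \<or> s0 j = -1" "\<And>j. s1 j = 1 \<or> s1 j = -1"
    and sums: "(\<Sum>j<m. s0 j) mod int n = 0" "(\<Sum>j<m. s1 j) mod int n = u mod int n"
    using sign_sums[OF _ n mn] m_ge_2 by fastforce
  \<comment> \<open>Only the last layer of a cycle to be prolonged gets the signs \<open>s1\<close>,
    so that one full turn contributes \<open>u\<close> in total. All other layers get sum 0 modulo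
    \<open>n\<close>.\<close>
  define s where "s f = (case f of (i, q, t) \<Rightarrow> if q < b i \<or> Suc t < n ^ i then s0 else s1)"
    for f :: "nat \<times> nat \<times> nat"
  define d where "d f = (\<Sum>j<m. s f j)" for f
  \<comment> \<open>Equal tree indices identify the tree arcs, since \<open>m \<ge> 2\<close>. A
    cycle arc takes the sign belonging to the index of its tail.\<close>
  define \<epsilon> where "\<epsilon> f e = (if fst (fst e) = fst (snd e) then 1 else s f (fst (fst e)))"
    for f and e :: "(nat \<times> 'v) \<times> (nat \<times> 'v)"
  \<comment> \<open>Signs are summed along the cycle up to the root, and the tree potential is
    added. At \<open>z\<close> the partial sum falls back to the empty one, which leaves over the
    complete sum \<open>d f\<close>.\<close>
  define \<pi> where "\<pi> f p = (\<Sum>i<fst p. s f i) + g (fst p) (snd p)" for f p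
  have sign: "\<epsilon> f e = 1 \<or> \<epsilon> f e = -1" for f e
    using s01 by (auto simp: \<epsilon>_def s_def split: prod.split)
  have pot: "\<pi> f (fst e) + \<epsilon> f e = (if e = z then d f else 0) + \<pi> (twist z (rot n) e f) (snd e)"
    if "e \<in> parcs G" for f e
    using that
  proof (cases rule: parcs_cases)
    case (tree j e' u v)
    then have "e \<noteq> z" using m_ge_2 by auto
    note not_z = if_not_P[OF this]
    show ?thesis
      unfolding twist_def not_z using tree g[OF tree(1,2), of u v] by (simp add: \<pi>_def \<epsilon>_def)
  next
    case (cyc j)
    have ne: "Suc j mod m \<noteq> j" by (rule Suc_mod_ne[OF cyc(1)])
    show ?thesis
    proof (cases "Suc j = m")
      case True
      then have "e = z" using cyc(2) by auto
      moreover have "\<epsilon> f z = s f (m - 1)" using True ne by (auto simp: \<epsilon>_def)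
      moreover have "(\<Sum>i<m - 1. s f i) + s f (m - 1) = d f"
        unfolding d_def using True by (metis diff_Suc_1 sum.lessThan_Suc)
      ultimately show ?thesis using True gw[of "m - 1"] gw[of 0] cyc(1) by (simp add: \<pi>_def)
    next
      case False
      then have "Suc j < m" using cyc(1) by simp
      moreover from this have "e \<noteq> z" using cyc(2) by auto
      note not_z = if_not_P[OF this]
      ultimately show ?thesis
        unfolding twist_def not_z using cyc gw[of j] gw[of "Suc j"] by (simp add: \<pi>_def \<epsilon>_def)
    qed
  qed
  obtain h where h: "h \<in> parcs D \<rightarrow> {P, M}"
    and lift': "is_lift G z (fibre n c \<times> {0..<int n}) (\<lambda>(f, y). (rot n f, (y + d f) mod int n))
      (h_product D (range x) h)"
    using h_product_is_lift[where n = "int n" and x = x and \<epsilon> = \<epsilon> and \<pi> = \<pi> and d = d, OF _ x_eq P M wf_G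
        rot_in_fibre[OF n0] sign pot lift] n0 by auto
  have "d (i, q, t) mod int n = (if q < b i \<or> Suc t < n ^ i then 0 else u) mod int n" for i q t
    using sums by (simp add: d_def s_def)
  from type_step_conjugate[OF n0 u step this]
  obtain \<gamma> where \<gamma>: "bij_betw \<gamma> (fibre n c') (fibre n c \<times> {0..<int n})"
    "\<And>f. f \<in> fibre n c' \<Longrightarrow> \<gamma> (rot n f) = (\<lambda>(f, y). (rot n f, (y + d f) mod int n)) (\<gamma> f)"
    by blast
  show ?thesis
    using h is_lift_conjugate[OF lift' wf_G \<gamma>] by blast
qed

text \<open>Start of the iteration: a single layer, which forms one cycle of length
  \<open>n ^ 0\<close> on which \<open>rot\<close> is the identity.\<close>

lemma is_lift_base:
  assumes "inj_on \<phi> (pverts G)"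
  shows "is_lift G z (fibre n (\<lambda>i. if i = 0 then 1 else 0)) (rot n) (relabel \<phi> G)"
proof -
  have F: "fibre n (\<lambda>i. if i = 0 then 1 else 0) = {(0, 0, 0)}"
    by (auto simp: fibre_def split: if_splits)
  have "inj_on (\<phi> \<circ> snd) ({(0 :: nat, 0 :: nat, 0 :: nat)} \<times> pverts G)"
    using assms by (auto simp: inj_on_def)
  moreover have "relabel snd (lift G z {(0, 0, 0)} (rot n)) = G"
  proof -
    have tw: "twist z (rot n) e (0, 0, 0) = (0, 0, 0)" for e by (simp add: twist_def)
    have "parcs (lift G z {(0, 0, 0)} (rot n)) =
        {(((0, 0, 0), fst e), (twist z (rot n) e (0, 0, 0), snd e)) | e. e \<in> parcs G}"
      by (simp add: lift_def)
    also have "\<dots> = (\<lambda>e. (((0, 0, 0), fst e), ((0, 0, 0), snd e))) ` parcs G"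
      unfolding tw by (rule Setcompr_eq_image)
    finally show ?thesis by (simp add: relabel_def image_comp) (simp add: lift_def)
  qed
  ultimately show ?thesis
    unfolding is_lift_def F
    by (intro exI[of _ "\<phi> \<circ> snd"] conjI) (simp_all only: flip: relabel_relabel)
qed

text \<open>Following the cycle of \<open>G\<close> upwards through a \<open>rot\<close>-cycle of
  length \<open>N\<close> takes \<open>N\<close> laps before it closes, so these layers form one
  component, the power of \<open>G\<close> with exponent \<open>N\<close>.\<close>

lemma und_lift_iso:
  assumes n: "n > 0" and lift: "is_lift G z (fibre n c) (rot n) D"
    and c: "\<And>i. i \<le> l \<Longrightarrow> c (s + i) = a i" "\<And>k. k < s \<or> s + l < k \<Longrightarrow> c k = 0"
  shows "ugraph_iso
    (disjoint_union {0..l} (\<lambda>i. copies (a i) (unicyclic_power m T w (n ^ (s + i))))) (und D)"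
    (is "ugraph_iso ?U _")
proof -
  obtain \<phi> where \<phi>: "inj_on \<phi> (fibre n c \<times> pverts G)"
    and D: "D = relabel \<phi> (lift G z (fibre n c) (rot n))"
    using lift by (auto simp: is_lift_def)
  have m0: "m > 0" using m_ge_2 by simp
  have lt: "t * m + j < m * N" if "t < N" "j < m" for t j N
  proof -
    have "t * m + j < Suc t * m" using that by simp
    also have "\<dots> \<le> N * m" using that by (intro mult_le_mono1) simp
    finally show ?thesis by (simp add: mult.commute)
  qed
  have div_lt: "J div m < N" if "J < m * N" for J N
    using that by (simp add: less_mult_imp_div_less mult.commute)
  have c_iff: "q < c k \<longleftrightarrow> s \<le> k \<and> k - s \<le> l \<and> q < a (k - s)" for k q
    using c(1)[of "k - s"] c(2)[of k] by (cases "s \<le> k \<and> k \<le> s + l") auto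
  \<comment> \<open>Position \<open>J\<close> on the long cycle is position \<open>J mod m\<close>
    in lap \<open>J div m\<close>, and the lap is the position within the \<open>rot\<close>-cycle.
    \<open>g0\<close> treats edges in the same way.\<close>
  define f0 where "f0 = (\<lambda>(i, q :: nat, J, v :: 'v). ((s + i, q, J div m), (J mod m, v)))"
  define g0 where "g0 = (\<lambda>(i, q :: nat, E :: nat \<times> 'e + nat).
    case E of Inl (J, e) \<Rightarrow> ((s + i, q, J div m), Inl (J mod m, e))
      | Inr J \<Rightarrow> ((s + i, q, J div m), Inr (J mod m)))"
  define arc where "arc = (\<lambda>(f, e). (\<phi> (f, fst e), \<phi> (twist z (rot n) e f, snd e)))"
  have vU: "uverts ?U = {(i, q, J, v). i \<le> l \<and> q < a i \<and> J < m * n ^ (s + i) \<and> v \<in> uverts (T (J mod m))}"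
    by (auto simp: disjoint_union_def copies_def unicyclic_power_def unicyclic_def)
  have eU: "uedges ?U = {(i, q, Inl (J, e)) | i q J e. i \<le> l \<and> q < a i \<and> J < m * n ^ (s + i) \<and>
      e \<in> uedges (T (J mod m))} \<union> {(i, q, Inr J) | i q J. i \<le> l \<and> q < a i \<and> J < m * n ^ (s + i)}"
    by (auto simp: disjoint_union_def copies_def unicyclic_power_def unicyclic_def)
  have "bij_betw f0 (uverts ?U) (fibre n c \<times> pverts G)"
    by (rule bij_betw_byWitness[where f' = "\<lambda>((k, q, t), (j, v)). (k - s, q, t * m + j, v)"])
      (use m0 in \<open>auto simp: f0_def vU fibre_def orient_def unicyclic_def lt div_lt c_iff\<close>)
  moreover have "bij_betw \<phi> (fibre n c \<times> pverts G) (uverts (und D))"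
    using \<phi> by (simp add: bij_betw_def D und_def relabel_def lift_def)
  ultimately have f: "bij_betw (\<phi> \<circ> f0) (uverts ?U) (uverts (und D))" by (rule bij_betw_trans)
  have "bij_betw g0 (uedges ?U) (fibre n c \<times> uedges (unicyclic m T w))"
    by (rule bij_betw_byWitness[where f' = "\<lambda>((k, q, t), E). (k - s, q,
        case E of Inl (j, e) \<Rightarrow> Inl (t * m + j, e) | Inr j \<Rightarrow> Inr (t * m + j))"])
      (use m0 in \<open>auto simp: g0_def eU fibre_def unicyclic_def lt div_lt c_iff\<close>)
  moreover have "bij_betw (map_prod id r) (fibre n c \<times> uedges (unicyclic m T w)) (fibre n c \<times> parcs G)"
    using orientation
    by (intro bij_betw_map_prod) (auto simp: bij_betw_def is_orientation_def orient_def)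
  moreover have "bij_betw arc (fibre n c \<times> parcs G) (uedges (und D))"
  proof -
    have tw: "twist z (rot n) e f \<in> fibre n c" if "f \<in> fibre n c" for e f
      using that rot_in_fibre[OF n] by (simp add: twist_def)
    have "inj_on arc (fibre n c \<times> parcs G)"
    proof (rule inj_onI)
      fix A A' assume A: "A \<in> fibre n c \<times> parcs G" "A' \<in> fibre n c \<times> parcs G" "arc A = arc A'"
      obtain f p q f' p' q' where AA: "A = (f, (p, q))" "A' = (f', (p', q'))"
        by (metis prod.exhaust)
      have *: "f \<in> fibre n c" "f' \<in> fibre n c" "(p, q) \<in> parcs G" "(p', q') \<in> parcs G"
        "arc (f, (p, q)) = arc (f', (p', q'))"
        using A by (simp_all add: AA)
      have "p \<in> pverts G" "q \<in> pverts G" "p' \<in> pverts G" "q' \<in> pverts G" using * wf_G by auto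
      then show "A = A'"
        unfolding AA using * tw[of f "(p, q)"] tw[of f' "(p', q')"] inj_onD[OF \<phi>, of "(f, p)" "(f', p')"]
          inj_onD[OF \<phi>, of "(twist z (rot n) (p, q) f, q)" "(twist z (rot n) (p', q') f', q')"]
        by (simp add: arc_def)
    qed
    moreover have "arc ` (fibre n c \<times> parcs G) = parcs D"
      by (simp add: D relabel_def parcs_lift image_comp arc_def comp_def case_prod_unfold)
    ultimately show ?thesis by (simp add: bij_betw_def und_def)
  qed
  ultimately have g: "bij_betw (arc \<circ> (map_prod id r \<circ> g0)) (uedges ?U) (uedges (und D))"
    by (blast intro: bij_betw_trans)
  have "uends (und D) ((arc \<circ> (map_prod id r \<circ> g0)) E) = (\<phi> \<circ> f0) ` uends ?U E"
    if "E \<in> uedges ?U" for E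
    using that unfolding eU
  proof (elim UnE CollectE exE conjE)
    fix i q J e assume E: "E = (i, q, Inl (J, e))" and e: "e \<in> uedges (T (J mod m))"
    have J: "J mod m < m" using m0 by simp
    obtain u v where uv: "r (Inl (J mod m, e)) = ((J mod m, u), (J mod m, v))"
      "uends (T (J mod m)) e = {u, v}"
      using tree_arcE[OF J e] by metis
    \<comment> \<open>The ends of \<open>z\<close> have different tree indices because
      \<open>m \<ge> 2\<close>, so a tree edge stays within its layer.\<close>
    have "((J mod m, u), (J mod m, v)) \<noteq> z" using m_ge_2 by auto
    then have "twist z (rot n) ((J mod m, u), (J mod m, v)) f = f" for f
      unfolding twist_def by (rule if_not_P)
    then show ?thesis using uv
      by (simp add: E und_def arc_def g0_def f0_def disjoint_union_def copies_def
          unicyclic_power_def unicyclic_def del: One_nat_def)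
  next
    fix i q J assume E: "E = (i, q, Inr J)" and J: "J < m * n ^ (s + i)"
    define N where "N = n ^ (s + i)"
    have "Suc J mod (m * N) = m * (Suc J div m mod N) + Suc J mod m"
      by (rule mod_mult2_eq)
    then have div: "Suc J mod (m * N) div m = Suc J div m mod N"
      and mod: "Suc J mod (m * N) mod m = Suc J mod m"
      using m0 by simp_all
    have JN: "J div m < N" using J div_lt by (simp add: N_def)
    have r: "r (Inr (J mod m)) = ((J mod m, w (J mod m)), (Suc J mod m, w (Suc J mod m)))"
      using forward[of "J mod m"] m0 by (simp add: mod_Suc_eq)
    \<comment> \<open>The lap number changes exactly when the position wraps, that is, on the arc
      \<open>z\<close>; its return to 0 after \<open>N\<close> laps agrees with
      \<open>rot\<close>.\<close>
    have "twist z (rot n) (r (Inr (J mod m))) (s + i, q, J div m) =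
        (s + i, q, Suc J div m mod N)"
    proof (cases "Suc (J mod m) = m")
      case True
      then have "J mod m = m - 1" by simp
      moreover have "Suc J mod m = 0" using True by (simp add: mod_Suc)
      ultimately show ?thesis
        using True unfolding r by (simp add: twist_def N_def div_Suc mod_Suc)
    next
      case False
      have "r (Inr (J mod m)) \<noteq> z" unfolding r using False m0 by auto
      moreover have "Suc J div m = J div m" using False by (simp add: div_Suc mod_Suc)
      ultimately show ?thesis using JN by (simp add: twist_def)
    qed
    then show ?thesis
      by (simp add: E und_def arc_def g0_def f0_def disjoint_union_def copies_def
          unicyclic_power_def unicyclic_def cycle_ugraph_def r div mod flip: N_def)
  qed
  then show ?thesis
    unfolding ugraph_iso_def using f g by blast
qed

end

section \<open>The schedule of cycle types\<close>

text \<open>\<open>\<beta> k\<close> is the partial sum in the integrality condition. Multiplication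
  by \<open>n\<close> gives the recurrence, and the total gives \<open>\<beta> l = 1\<close>. In the
  schedule, \<open>\<beta> k\<close> counts the cycles split \<open>k\<close> steps before the last
  step.\<close>

lemma weighted_sums_nat:
  fixes a :: "nat \<Rightarrow> nat" and n l :: nat
  assumes n: "n > 0"
    and l0: "l = 0 \<Longrightarrow> a 0 = n"
    and total: "l \<ge> 1 \<Longrightarrow> (\<Sum>i=0..l. real (a i) / real n ^ (l - i)) = real n"
    and integral: "\<And>k. l \<ge> 1 \<Longrightarrow> k \<le> l - 1 \<Longrightarrow>
      (\<Sum>i=0..k. real (a i) / real n ^ (k - i + 1)) \<in> real ` {z. z > 0}"
  shows "\<exists>\<beta>. \<beta> l = 1 \<and> n * \<beta> 0 = a 0 \<and> (\<forall>k<l. n * \<beta> (Suc k) = \<beta> k + a (Suc k))"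
proof -
  define S where "S k = (\<Sum>i=0..k. real (a i) / real n ^ (k - i + 1))" for k
  have S0: "real n * S 0 = real (a 0)" using n by (simp add: S_def)
  have nS: "real n * S k = (\<Sum>i=0..k. real (a i) / real n ^ (k - i))" for k
    using n by (simp add: S_def sum_distrib_left)
  have SS: "real n * S (Suc k) = S k + real (a (Suc k))" for k
    unfolding nS by (simp add: S_def Suc_diff_le)
  have Sl: "S l = 1"
  proof (cases "l = 0")
    case True
    then show ?thesis using l0 n by (simp add: S_def)
  next
    case False
    then have "real n * S l = real n" using total nS by simp
    then show ?thesis using n by simp
  qed
  have "\<exists>z. real z = S k" if "k \<le> l" for k
  proof (cases "k = l")
    case True
    then show ?thesis using Sl by (intro exI[of _ 1]) simp
  next
    case False
    then have "l \<ge> 1" "k \<le> l - 1" using that by auto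
    from integral[OF this] have "S k \<in> real ` {z. z > 0}" unfolding S_def .
    then show ?thesis by (elim imageE) (auto intro: sym)
  qed
  then have "\<forall>k. \<exists>z. k \<le> l \<longrightarrow> real z = S k" by blast
  from choice[OF this] obtain \<beta> where \<beta>: "\<And>k. k \<le> l \<Longrightarrow> real (\<beta> k) = S k" by blast
  have "real (\<beta> l) = real 1" using \<beta> Sl by simp
  then have "\<beta> l = 1" unfolding of_nat_eq_iff .
  moreover have "real (n * \<beta> 0) = real (a 0)" using \<beta>[of 0] S0 by simp
  then have "n * \<beta> 0 = a 0" unfolding of_nat_eq_iff .
  moreover have "n * \<beta> (Suc k) = \<beta> k + a (Suc k)" if "k < l" for k
  proof -
    have "real (n * \<beta> (Suc k)) = real (\<beta> k + a (Suc k))"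
      using \<beta>[of k] \<beta>[of "Suc k"] SS[of k] that by simp
    then show ?thesis unfolding of_nat_eq_iff .
  qed
  ultimately show ?thesis by (intro exI[of _ \<beta>]) simp
qed

text \<open>
  The counts \<open>a\<close> are reached backwards: the \<open>a 0\<close> shortest cycles arise by splitting \<open>\<beta> 0\<close> cycles,
  all other ones from shorter cycles, so the preceding counts are \<open>\<beta> 0 + a 1, a 2, ..., a l\<close>.
\<close>

lemma type_schedule:
  fixes a \<beta> :: "nat \<Rightarrow> nat" and n l s :: nat
  assumes \<beta>l: "\<beta> l = 1" and \<beta>0: "n * \<beta> 0 = a 0"
    and \<beta>S: "\<And>k. k < l \<Longrightarrow> n * \<beta> (Suc k) = \<beta> k + a (Suc k)"
  shows "\<exists>C. (\<forall>j\<le>s. C j = (\<lambda>k. if k = j then 1 else 0)) \<and>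
    (\<forall>i\<le>l. C (l + s + 1) (s + i) = a i) \<and> (\<forall>k. k < s \<or> s + l < k \<longrightarrow> C (l + s + 1) k = 0) \<and>
    (\<forall>j<l + s + 1. \<exists>b. type_step n b (C j) (C (Suc j)))"
proof -
  \<comment> \<open>Up to step \<open>s\<close> a single cycle is prolonged. With
    \<open>d = j - s\<close> positive, there are \<open>n * \<beta> (l + 1 - d)\<close> cycles of
    length \<open>n ^ s\<close>, and \<open>a (l + 1 - d + p)\<close> of length
    \<open>n ^ (s + p)\<close> for \<open>0 < p < d\<close>. At \<open>d = l + 1\<close> these are
    the required counts.\<close>
  define C where "C j k = (if j \<le> s then (if k = j then 1 else 0) else if k < s then 0
    else if k = s then n * \<beta> (l + 1 - (j - s))
    else if k - s < j - s then a (l + 1 - (j - s) + (k - s)) else 0)" for j k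
  have "\<exists>b. type_step n b (C j) (C (Suc j))" if j: "j < l + s + 1" for j
  proof -
    \<comment> \<open>Only cycles of length \<open>n ^ s\<close> are ever split, beginning with the
      single cycle at \<open>j = s\<close>, where \<open>\<beta> l = 1\<close>.\<close>
    define b where "b k = (if s \<le> j \<and> k = s then \<beta> (l - (j - s)) else 0)" for k
    \<comment> \<open>The cycles of length \<open>n ^ s\<close> divide into those split next and
      those prolonged; the latter already have the number required in the end.\<close>
    have late: "n * \<beta> (l + 1 - (j - s)) = \<beta> (l - (j - s)) + a (l + 1 - (j - s))" if "s < j"
      using \<beta>S[of "l - (j - s)"] that j by (simp add: Suc_diff_le)
    have "b i \<le> C j i" for i
      using \<beta>l late unfolding b_def C_def by (cases "s < j"; cases "j = s") simp_all
    moreover have "C (Suc j) 0 = n * b 0"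
      unfolding b_def C_def by (cases "s < j"; cases "j = s") simp_all
    moreover have "C (Suc j) (Suc i) = n * b (Suc i) + (C j i - b i)" for i
    proof (cases "j \<le> s")
      case True
      then show ?thesis
        using \<beta>l unfolding b_def C_def by (cases "j = s"; cases "i = j"; cases "Suc i < s") simp_all
    next
      case False
      then obtain jj where jj: "j = s + Suc jj" by (metis add_Suc_right less_iff_Suc_add not_le)
      consider "i < s" | "i = s" | p where "i = s + Suc p"
        by (metis add_Suc_right less_iff_Suc_add linorder_neqE_nat)
      then show ?thesis
      proof cases
        case 1
        then show ?thesis using jj by (auto simp: b_def C_def)
      next
        case 2
        then show ?thesis using jj late j by (auto simp: b_def C_def Suc_diff_Suc)
      next
        case 3
        have "l + 1 - (Suc j - s) + (s + Suc (Suc p) - s) = l + 1 - (j - s) + (s + Suc p - s)"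
          using jj j by simp
        moreover have "Suc (l + p - Suc jj) = l + p - jj" using jj j by simp
        ultimately show ?thesis using jj 3 unfolding b_def C_def by (cases "p < jj") simp_all
      qed
    qed
    ultimately show ?thesis unfolding type_step_def by blast
  qed
  moreover have "C (l + s + 1) (s + i) = a i" if "i \<le> l" for i
    using that \<beta>0 by (cases i) (auto simp: C_def)
  moreover have "C j = (\<lambda>k. if k = j then 1 else 0)" if "j \<le> s" for j
    using that by (auto simp: C_def)
  moreover have "C (l + s + 1) k = 0" if "k < s \<or> s + l < k" for k
    using that by (auto simp: C_def)
  ultimately show ?thesis by blast
qed

section \<open>Iterated products\<close>

text \<open>Indexing the vertices by integers modulo \<open>n\<close> turns the arcs into
  translations by 1 or by -1.\<close>

lemma strongly_oriented_cycle_param: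
  fixes C :: "'c pair_pre_digraph"
  assumes n: "n \<ge> 2" and C: "strongly_oriented_cycle n C"
  obtains x :: "int \<Rightarrow> 'c"
  where "\<And>i j. x i = x j \<longleftrightarrow> i mod int n = j mod int n" and "pverts C = range x"
    and "parcs C = range (\<lambda>i. (x i, x (i + 1))) \<or> parcs C = range (\<lambda>i. (x (i + 1), x i))"
proof -
  obtain a r where a: "inj_on a {..<n}" and r: "is_strong_orientation (cycle_ugraph n a) r"
    and C_eq: "C = orient (cycle_ugraph n a) r"
    using C by (auto simp: strongly_oriented_cycle_def)
  define x where "x i = a (nat (i mod int n))" for i
  have nat_lt: "nat (i mod int n) < n" for i using n by (simp add: nat_less_iff)
  have x_eq: "x i = x j \<longleftrightarrow> i mod int n = j mod int n" for i j
    using inj_on_eq_iff[OF a, of "nat (i mod int n)" "nat (j mod int n)"] nat_lt n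
    by (simp add: x_def eq_nat_nat_iff)
  have x_nat: "x (int j) = a j" "x (int j + 1) = a (Suc j mod n)" if "j < n" for j
  proof -
    show "x (int j) = a j" using that by (simp add: x_def)
    have "(int j + 1) mod int n = int (Suc j mod n)" by (simp add: zmod_int add.commute)
    then show "x (int j + 1) = a (Suc j mod n)" by (simp add: x_def)
  qed
  have image_x: "(\<lambda>j. F (a j) (a (Suc j mod n))) ` {..<n} = range (\<lambda>i. F (x i) (x (i + 1)))"
    for F :: "'c \<Rightarrow> 'c \<Rightarrow> 'd"
  proof (intro equalityI subsetI)
    fix y assume "y \<in> (\<lambda>j. F (a j) (a (Suc j mod n))) ` {..<n}"
    then obtain j where "j < n" "y = F (a j) (a (Suc j mod n))" by blast
    then have "y = F (x (int j)) (x (int j + 1))" using x_nat[of j] by simp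
    then show "y \<in> range (\<lambda>i. F (x i) (x (i + 1)))" by blast
  next
    fix y assume "y \<in> range (\<lambda>i. F (x i) (x (i + 1)))"
    then obtain i where y: "y = F (x i) (x (i + 1))" by blast
    have "x i = x (int (nat (i mod int n)))" "x (i + 1) = x (int (nat (i mod int n)) + 1)"
      using n by (simp_all add: x_eq mod_simps)
    then have "y = F (a (nat (i mod int n))) (a (Suc (nat (i mod int n)) mod n))"
      using y x_nat[OF nat_lt] by simp
    then show "y \<in> (\<lambda>j. F (a j) (a (Suc j mod n))) ` {..<n}" using nat_lt by blast
  qed
  have pv: "pverts C = range x"
    using image_x[of "\<lambda>u _. u"] by (simp add: C_eq orient_def cycle_ugraph_def)
  have pa: "parcs C = r ` {..<n}" by (simp add: C_eq orient_def cycle_ugraph_def)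
  from strong_orientation_cycle_cases[OF n a r]
  have "parcs C = range (\<lambda>i. (x i, x (i + 1))) \<or> parcs C = range (\<lambda>i. (x (i + 1), x i))"
  proof
    assume "\<forall>j<n. r j = (a j, a (Suc j mod n))"
    then have "r ` {..<n} = (\<lambda>j. (a j, a (Suc j mod n))) ` {..<n}" by (intro image_cong) auto
    then show ?thesis using image_x[of Pair] pa by simp
  next
    assume "\<forall>j<n. r j = (a (Suc j mod n), a j)"
    then have "r ` {..<n} = (\<lambda>j. (a (Suc j mod n), a j)) ` {..<n}" by (intro image_cong) auto
    then show ?thesis using image_x[of "\<lambda>u v. (v, u)"] pa by simp
  qed
  then show thesis using that x_eq pv by blast
qed

text \<open>Runs \<open>h_product_type_step\<close> along the schedule, starting with one layer, and
  reads off the graphs after \<open>s\<close> and after \<open>l + s + 1\<close> products.\<close>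

lemma (in unicyclic_orientation) iterated_products:
  fixes l n s :: nat and x :: "int \<Rightarrow> 'c" and P M :: "'c pair_pre_digraph" and a \<beta> :: "nat \<Rightarrow> nat"
  assumes n: "odd n" and mn: "odd m \<Longrightarrow> m \<ge> n"
    and x_eq: "\<And>i j. x i = x j \<longleftrightarrow> i mod int n = j mod int n"
    and P: "parcs P = range (\<lambda>i. (x i, x (i + 1)))"
    and M: "parcs M = range (\<lambda>i. (x (i + 1), x i))"
    and \<beta>: "\<beta> l = 1" "n * \<beta> 0 = a 0" "\<And>k. k < l \<Longrightarrow> n * \<beta> (Suc k) = \<beta> k + a (Suc k)"
  shows "\<exists>(D :: nat \<Rightarrow> (nat \<times> 'v, 'c) iterated_vertex pair_pre_digraph) h.
    D 1 = relabel Base G \<and>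
    (\<forall>i\<in>{1..l + s + 1}. h i \<in> parcs (D i) \<rightarrow> {P, M} \<and>
       D (i + 1) = relabel (\<lambda>(v, x). IPair v x) (h_product (D i) (range x) (h i))) \<and>
    ugraph_iso (unicyclic_power m T w (n ^ s)) (und (D (s + 1))) \<and>
    ugraph_iso
      (disjoint_union {0..l} (\<lambda>i. copies (a i) (unicyclic_power m T w (n ^ (s + i)))))
      (und (D (l + s + 2)))"
proof -
  have n0: "n > 0" using n by (rule odd_pos)
  define N where "N = l + s + 1"
  obtain C where C_unit: "\<And>j. j \<le> s \<Longrightarrow> C j = (\<lambda>k. if k = j then 1 else 0)"
    and C_end: "\<And>i. i \<le> l \<Longrightarrow> C N (s + i) = a i" "\<And>k. k < s \<or> s + l < k \<Longrightarrow> C N k = 0"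
    and C_step: "\<And>j. j < N \<Longrightarrow> \<exists>b. type_step n b (C j) (C (Suc j))"
    using type_schedule[OF \<beta>, of s] unfolding N_def by blast
  define pair :: "(nat \<times> 'v, 'c) iterated_vertex \<times> 'c \<Rightarrow> (nat \<times> 'v, 'c) iterated_vertex"
    where "pair = (\<lambda>(v, x). IPair v x)"
  \<comment> \<open>The bounds by \<open>N\<close> here and in \<open>Q\<close> leave the sequence
    free beyond the schedule, so dependent choice can run over all natural numbers.\<close>
  define L where "L j D \<longleftrightarrow> (j \<le> N \<longrightarrow> is_lift G z (fibre n (C j)) (rot n) D) \<and>
      (j = 0 \<longrightarrow> D = relabel Base G)"
    for j and D :: "(nat \<times> 'v, 'c) iterated_vertex pair_pre_digraph"
  define Q where "Q j D D' \<longleftrightarrow>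
      (j < N \<longrightarrow> (\<exists>h. h \<in> parcs D \<rightarrow> {P, M} \<and> D' = relabel pair (h_product D (range x) h)))"
    for j :: nat and D D'
  have "\<exists>f. \<forall>j. L j (f j) \<and> Q j (f j) (f (Suc j))"
  proof (rule dependent_nat_choice)
    have "inj_on Base (pverts G)" by (simp add: inj_on_def)
    then have "L 0 (relabel Base G)"
      unfolding L_def using is_lift_base C_unit[of 0] by simp
    then show "\<exists>D. L 0 D" by blast
  next
    fix D j assume D: "L j D"
    show "\<exists>D'. L (Suc j) D' \<and> Q j D D'"
    proof (cases "j < N")
      case True
      then obtain b where b: "type_step n b (C j) (C (Suc j))" using C_step by blast
      have lift: "is_lift G z (fibre n (C j)) (rot n) D" using D True by (simp add: L_def)
      obtain h where h: "h \<in> parcs D \<rightarrow> {P, M}"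
        "is_lift G z (fibre n (C (Suc j))) (rot n) (h_product D (range x) h)"
        using h_product_type_step[OF n mn x_eq P M b lift] by blast
      have "inj_on pair (pverts (h_product D (range x) h))"
        by (auto simp: inj_on_def pair_def)
      from is_lift_relabel[OF h(2) this] h(1) show ?thesis
        unfolding L_def Q_def by blast
    next
      case False
      then show ?thesis by (simp add: L_def Q_def)
    qed
  qed
  then obtain f where L: "\<And>j. L j (f j)" and Q: "\<And>j. Q j (f j) (f (Suc j))" by blast
  have "\<forall>j. \<exists>h. j < N \<longrightarrow> h \<in> parcs (f j) \<rightarrow> {P, M} \<and>
      f (Suc j) = relabel pair (h_product (f j) (range x) h)"
    using Q unfolding Q_def by blast
  then obtain h where h: "\<And>j. j < N \<Longrightarrow> h j \<in> parcs (f j) \<rightarrow> {P, M} \<and>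
      f (Suc j) = relabel pair (h_product (f j) (range x) (h j))"
    by metis
  have final: "ugraph_iso (disjoint_union {0..l} (\<lambda>i. copies (a i) (unicyclic_power m T w (n ^ (s + i)))))
      (und (f N))"
    using und_lift_iso[OF n0, of "C N" "f N" l s a] C_end L[of N] by (simp add: L_def)
  \<comment> \<open>After \<open>s\<close> prolongations there is one cycle of length
    \<open>n ^ s\<close>: the case \<open>l = 0\<close> of \<open>und_lift_iso\<close> with count
    1.\<close>
  have "is_lift G z (fibre n (C s)) (rot n) (f s)" using L[of s] by (simp add: L_def N_def)
  then have "ugraph_iso (disjoint_union {0..0 :: nat} (\<lambda>i. copies (Suc 0) (unicyclic_power m T w (n ^ (s + i)))))
      (und (f s))"
    by (rule und_lift_iso[OF n0]) (auto simp: C_unit)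
  then have initial: "ugraph_iso (unicyclic_power m T w (n ^ s)) (und (f s))"
    using ugraph_iso_trans[OF ugraph_iso_single_copy[of "\<lambda>i. unicyclic_power m T w (n ^ (s + i))"]]
    by simp
  have "f 0 = relabel Base G" using L[of 0] by (simp add: L_def)
  moreover have "h (i - 1) \<in> parcs (f (i - 1)) \<rightarrow> {P, M} \<and>
      f (i + 1 - 1) = relabel (\<lambda>(v, x). IPair v x) (h_product (f (i - 1)) (range x) (h (i - 1)))"
    if "i \<in> {1..l + s + 1}" for i
    using h[of "i - 1"] that unfolding N_def pair_def by (cases i) simp_all
  \<comment> \<open>\<open>f\<close> counts products from 0 whereas the required sequence starts at
    index 1, hence the shift.\<close>
  ultimately show ?thesis
    using initial final unfolding N_def
    by (intro exI[of _ "\<lambda>i. f (i - 1)"] exI[of _ "\<lambda>i. h (i - 1)"]) auto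
qed

section \<open>Reversal of all arcs\<close>

lemma parcs_reverse_digraph: "parcs (reverse_digraph D) = prod.swap ` parcs D"
  by (force simp: reverse_digraph_def)

lemma relabel_reverse_digraph: "relabel f (reverse_digraph D) = reverse_digraph (relabel f D)"
  by (auto simp: relabel_def reverse_digraph_def image_iff)

lemma h_product_reverse_digraph:
  "h_product (reverse_digraph D) V (\<lambda>e. reverse_digraph (h (prod.swap e))) =
    reverse_digraph (h_product D V h)"
  by (auto simp: h_product_def reverse_digraph_def)

lemma ugraph_iso_und_reverse_digraph:
  assumes "ugraph_iso H (und D)"
  shows "ugraph_iso H (und (reverse_digraph D))"
proof -
  have "ugraph_iso (und D) (und (reverse_digraph D))"
    unfolding ugraph_iso_def
    by (rule exI[of _ id], rule exI[of _ prod.swap])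
      (auto simp: und_def parcs_reverse_digraph bij_betw_def, simp_all add: reverse_digraph_def)
  then show ?thesis using assms ugraph_iso_trans by blast
qed

theorem theorem3p4:
  fixes l m n s :: nat
    and T :: "nat \<Rightarrow> ('v, 'e) ugraph" and w :: "nat \<Rightarrow> 'v"
    and D1 :: "(nat \<times> 'v) pair_pre_digraph"
    and Cp Cm :: "'c pair_pre_digraph"
    and a :: "nat \<Rightarrow> nat"
  assumes "m \<ge> 1" and "n \<ge> 3" and "odd n" and "odd m \<Longrightarrow> m \<ge> n"
    and "\<And>j. j < m \<Longrightarrow> is_tree (T j) \<and> w j \<in> uverts (T j)"
    and "cycle_strong_orientation m T w D1"
    and "strongly_oriented_cycle n Cp" and "Cm = reverse_digraph Cp"
    and "l = 0 \<Longrightarrow> a 0 = n"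
    and "l \<ge> 1 \<Longrightarrow> (\<Sum>i=0..l. real (a i) / real n ^ (l - i)) = real n"
    and "\<And>k. l \<ge> 1 \<Longrightarrow> k \<le> l - 1 \<Longrightarrow>
           (\<Sum>i=0..k. real (a i) / real n ^ (k - i + 1)) \<in> real ` {z. z > 0}"
  shows "\<exists>(D :: nat \<Rightarrow> (nat \<times> 'v, 'c) iterated_vertex pair_pre_digraph) h.
           D 1 = relabel Base D1 \<and>
           (\<forall>i\<in>{1..l + s + 1}. h i \<in> parcs (D i) \<rightarrow> {Cp, Cm} \<and>
              D (i + 1) = relabel (\<lambda>(v, x). IPair v x) (h_product (D i) (pverts Cp) (h i))) \<and>
           ugraph_iso (unicyclic_power m T w (n ^ s)) (und (D (s + 1))) \<and>
           ugraph_iso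
             (disjoint_union {0..l} (\<lambda>i. copies (a i) (unicyclic_power m T w (n ^ (s + i)))))
             (und (D (l + s + 2)))"
proof -
  \<comment> \<open>\<open>m = 1\<close> is impossible: an odd \<open>m\<close> is at least
    \<open>n\<close>, hence at least 3.\<close>
  have m2: "m \<ge> 2"
  proof (cases "odd m")
    case True
    then show ?thesis using assms(2,4) by linarith
  next
    case False
    then show ?thesis using assms(1) by (cases "m = 1") auto
  qed
  obtain \<beta> where \<beta>: "\<beta> l = 1" "n * \<beta> 0 = a 0" "\<And>k. k < l \<Longrightarrow> n * \<beta> (Suc k) = \<beta> k + a (Suc k)"
    using weighted_sums_nat[of n l a] assms(2,9,10,11) by auto
  have "n \<ge> 2" using assms(2) by simp
  then obtain x :: "int \<Rightarrow> 'c" where x_eq: "\<And>i j. x i = x j \<longleftrightarrow> i mod int n = j mod int n"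
    and pv: "pverts Cp = range x"
    and pa: "parcs Cp = range (\<lambda>i. (x i, x (i + 1))) \<or> parcs Cp = range (\<lambda>i. (x (i + 1), x i))"
    using strongly_oriented_cycle_param[OF _ assms(7)] by blast
  have rev: "parcs Cm = (parcs Cp)\<inverse>" "reverse_digraph Cp = Cm" "reverse_digraph Cm = Cp"
    using assms(8) by (simp_all add: reverse_digraph_def)
  \<comment> \<open>The two cycles enter symmetrically, so \<open>P\<close> may be the one that
    agrees with increasing indices.\<close>
  obtain P M where PM: "{P, M} = {Cp, Cm}"
    "parcs P = range (\<lambda>i. (x i, x (i + 1)))" "parcs M = range (\<lambda>i. (x (i + 1), x i))"
  proof (cases "parcs Cp = range (\<lambda>i. (x i, x (i + 1)))")
    case True
    then have "parcs Cm = range (\<lambda>i. (x (i + 1), x i))" unfolding rev by auto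
    then show thesis using that[of Cp Cm] True by blast
  next
    case False
    then have *: "parcs Cp = range (\<lambda>i. (x (i + 1), x i))" using pa by blast
    then have "parcs Cm = range (\<lambda>i. (x i, x (i + 1)))" unfolding rev by auto
    then show thesis using that[of Cm Cp] * by blast
  qed
  obtain r where r: "is_orientation (unicyclic m T w) r"
    "is_strong_orientation (cycle_ugraph m (\<lambda>j. (j, w j))) (r \<circ> Inr)"
    and D1: "D1 = orient (unicyclic m T w) r"
    using assms(6) by (auto simp: cycle_strong_orientation_def)
  have "inj_on (\<lambda>j. (j, w j)) {..<m}" by (simp add: inj_on_def)
  from strong_orientation_cycle_cases[OF m2 this r(2)] show ?thesis
  proof
    assume "\<forall>j<m. (r \<circ> Inr) j = ((j, w j), (Suc j mod m, w (Suc j mod m)))"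
    then interpret unicyclic_orientation m T w r
      using m2 assms(5) r(1) by unfold_locales auto
    show ?thesis
      using iterated_products[OF assms(3,4) x_eq PM(2,3) \<beta>] unfolding PM(1) pv D1 by blast
  next
    \<comment> \<open>Reversing all arcs makes the cycle run forward. The sequence built for the
      reversed graph is then reversed termwise; this exchanges \<open>Cp\<close> and
      \<open>Cm\<close> in the values of \<open>h\<close> and does not change the underlying graphs
      up to isomorphism.\<close>
    let ?r = "prod.swap \<circ> r"
    assume bwd: "\<forall>j<m. (r \<circ> Inr) j = ((Suc j mod m, w (Suc j mod m)), (j, w j))"
    have "is_orientation (unicyclic m T w) ?r"
      using r(1)
      by (auto simp: is_orientation_def insert_commute intro: comp_inj_on inj_on_subset)
    then interpret unicyclic_orientation m T w ?r
      using bwd m2 assms(5) by unfold_locales auto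
    have D1': "D1 = reverse_digraph (orient (unicyclic m T w) ?r)"
      using parcs_reverse_digraph[of "orient (unicyclic m T w) ?r"]
      by (simp add: D1 orient_def reverse_digraph_def image_comp comp_def)
    obtain D :: "nat \<Rightarrow> (nat \<times> 'v, 'c) iterated_vertex pair_pre_digraph" and h
      where D: "D 1 = relabel Base (orient (unicyclic m T w) ?r)"
      and h: "\<And>i. i \<in> {1..l + s + 1} \<Longrightarrow> h i \<in> parcs (D i) \<rightarrow> {Cp, Cm} \<and>
        D (i + 1) = relabel (\<lambda>(v, x). IPair v x) (h_product (D i) (pverts Cp) (h i))"
      and iso: "ugraph_iso (unicyclic_power m T w (n ^ s)) (und (D (s + 1)))"
        "ugraph_iso (disjoint_union {0..l} (\<lambda>i. copies (a i) (unicyclic_power m T w (n ^ (s + i)))))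
          (und (D (l + s + 2)))"
      using iterated_products[OF assms(3,4) x_eq PM(2,3) \<beta>] unfolding PM(1) pv by blast
    define D' where "D' i = reverse_digraph (D i)" for i
    define h' where "h' i = (\<lambda>e. reverse_digraph (h i (prod.swap e)))" for i
    have "D' 1 = relabel Base D1"
      unfolding D'_def D D1' relabel_reverse_digraph ..
    moreover have "h' i \<in> parcs (D' i) \<rightarrow> {Cp, Cm} \<and>
        D' (i + 1) = relabel (\<lambda>(v, x). IPair v x) (h_product (D' i) (pverts Cp) (h' i))"
      if i: "i \<in> {1..l + s + 1}" for i
    proof
      show "h' i \<in> parcs (D' i) \<rightarrow> {Cp, Cm}"
      proof
        fix e assume "e \<in> parcs (D' i)"
        then have "prod.swap e \<in> parcs (D i)" by (auto simp: D'_def reverse_digraph_def)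
        then have "h i (prod.swap e) \<in> {Cp, Cm}" using h[OF i] by blast
        then show "h' i e \<in> {Cp, Cm}" using rev(2,3) by (auto simp: h'_def)
      qed
      show "D' (i + 1) = relabel (\<lambda>(v, x). IPair v x) (h_product (D' i) (pverts Cp) (h' i))"
        using h[OF i] unfolding D'_def h'_def h_product_reverse_digraph relabel_reverse_digraph
        by simp
    qed
    ultimately show ?thesis
      using iso[THEN ugraph_iso_und_reverse_digraph] unfolding D'_def[symmetric] by blast
  qed
qed

end
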